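(* Let $f:\mathcal{C}(1)\to\mathcal{C}(2)$ be a morphism of regular exact couples of $R$-modules (with bidegrees $\mathbf{a},\mathbf{b},\mathbf{c}$) such that for a given $n\in\mathbb{Z}$ the following hold: (i) For all $\mathbf{x}$ with $\det[\mathbf{a}\ \mathbf{x}]=n$ the map $f$ induces an isomorphism $\varepsilon_{\mathbf{x}}(1)\to\varepsilon_{\mathbf{x}}(2)$. (ii) $f$ induces an epimorphism $\lim_rF_{\mathbf{x}(n)+r\mathbf{a}}(1)\to\lim_rF_{\mathbf{x}(n)+r\mathbf{a}}(2)$. (iii) $f$ induces a monomorphism $\lim^1_rF_{\mathbf{x}(n)+r\mathbf{a}}(1)\to\lim^1_rF_{\mathbf{x}(n)+r\mathbf{a}}(2)$. Then $f$ induces an epimorphism $L_nf:L_n(1)\to L_n(2)$. If the map in (ii) is an isomorphism, then so is $L_nf$.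
   Context: $R$ is a unital ring. A $(\mathbb{Z}\times\mathbb{Z})$-bigraded exact couple $(E,D,i,j,k)$ with bidegrees $\mathbf{a},\mathbf{b},\mathbf{c}\in\mathbb{Z}\times\mathbb{Z}$ consists of families of $R$-modules $D_{\mathbf{x}},E_{\mathbf{x}}$ ($\mathbf{x}\in\mathbb{Z}\times\mathbb{Z}$) and $R$-linear maps $i_{\mathbf{x}}:D_{\mathbf{x}}\to D_{\mathbf{x}+\mathbf{a}}$, $j_{\mathbf{x}}:D_{\mathbf{x}}\to E_{\mathbf{x}+\mathbf{b}}$, $k_{\mathbf{x}}:E_{\mathbf{x}}\to D_{\mathbf{x}+\mathbf{c}}$ such that $D_{\mathbf{x}-\mathbf{a}}\xrightarrow{i}D_{\mathbf{x}}\xrightarrow{j}E_{\mathbf{x}+\mathbf{b}}\xrightarrow{k}D_{\mathbf{x}+\mathbf{b}+\mathbf{c}}\xrightarrow{i}D_{\mathbf{x}+\mathbf{a}+\mathbf{b}+\mathbf{c}}$ is exact for all $\mathbf{x}$. It is regular if $\sigma:=\det[\mathbf{a}\ (\mathbf{b}+\mathbf{c})]\in\{1,-1\}$. A morphism of exact couples with equal bidegrees is a pair of families $D_{\mathbf{x}}(1)\to D_{\mathbf{x}}(2)$, $E_{\mathbf{x}}(1)\to E_{\mathbf{x}}(2)$ of $R$-linear maps commuting with $i,j,k$. Put $\mathbf{x}(n)=\sigma n(\mathbf{b}+\mathbf{c})$; then $\det[\mathbf{a}\ \mathbf{x}]=n$ iff $\mathbf{x}=\mathbf{x}(n)+r\mathbf{a}$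 for some $r\in\mathbb{Z}$. The colimit abutment $L_n$ is the colimit of the diagram $r\mapsto D_{\mathbf{x}(n)+r\mathbf{a}}$ ($r\in\mathbb{Z}$, structure maps $i$), filtered by $F_{\mathbf{x}}=\operatorname{im}(D_{\mathbf{x}}\to L_n)$ for $\det[\mathbf{a}\ \mathbf{x}]=n$, and $\varepsilon_{\mathbf{x}}=F_{\mathbf{x}}/F_{\mathbf{x}-\mathbf{a}}$. $\lim_r$ and $\lim^1_r$ are the limit and its first derived functor for the $\mathbb{Z}$-indexed diagram of inclusions $\cdots\subseteq F_{\mathbf{x}(n)+r\mathbf{a}}\subseteq F_{\mathbf{x}(n)+(r+1)\mathbf{a}}\subseteq\cdots$. Morphisms of exact couples induce maps on all these objects. *)

theory Defs
  imports "HOL-Algebra.Module" "HOL-Algebra.AbelCoset" "HOL-Library.Product_Plus"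
begin

section \<open>Modules over a unital ring\<close>

text \<open>
  The locale \<^verbatim>\<open>module\<close> of HOL-Algebra requires commutative scalars, so left modules over an
  arbitrary unital ring are introduced here, on the same record type.  The fields \<^verbatim>\<open>mult\<close> and
  \<^verbatim>\<open>one\<close> which that record inherits from rings carry no meaning for modules; they are left
  \<^verbatim>\<open>undefined\<close> in the constructions below.
\<close>

locale left_module = R?: ring R + M?: abelian_group M
  for R :: "('r, 'z) ring_scheme" (structure) and M :: "('r, 'm) module" (structure) +
  assumes smult_closed [simp, intro]:
      "\<lbrakk>a \<in> carrier R; x \<in> carrier M\<rbrakk> \<Longrightarrow> a \<odot>\<^bsub>M\<^esub> x \<in> carrier M"
    and smult_l_distr:
      "\<lbrakk>a \<in> carrier R; b \<in> carrier R; x \<in> carrier M\<rbrakk>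
        \<Longrightarrow> (a \<oplus>\<^bsub>R\<^esub> b) \<odot>\<^bsub>M\<^esub> x = a \<odot>\<^bsub>M\<^esub> x \<oplus>\<^bsub>M\<^esub> b \<odot>\<^bsub>M\<^esub> x"
    and smult_r_distr:
      "\<lbrakk>a \<in> carrier R; x \<in> carrier M; y \<in> carrier M\<rbrakk>
        \<Longrightarrow> a \<odot>\<^bsub>M\<^esub> (x \<oplus>\<^bsub>M\<^esub> y) = a \<odot>\<^bsub>M\<^esub> x \<oplus>\<^bsub>M\<^esub> a \<odot>\<^bsub>M\<^esub> y"
    and smult_assoc1:
      "\<lbrakk>a \<in> carrier R; b \<in> carrier R; x \<in> carrier M\<rbrakk>
        \<Longrightarrow> (a \<otimes>\<^bsub>R\<^esub> b) \<odot>\<^bsub>M\<^esub> x = a \<odot>\<^bsub>M\<^esub> (b \<odot>\<^bsub>M\<^esub> x)"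
    and smult_one [simp]: "x \<in> carrier M \<Longrightarrow> \<one>\<^bsub>R\<^esub> \<odot>\<^bsub>M\<^esub> x = x"

definition lin_hom :: "('r, 'z) ring_scheme \<Rightarrow> ('r, 'm) module \<Rightarrow> ('r, 'n) module \<Rightarrow> ('m \<Rightarrow> 'n) set" where
  "lin_hom R M N = {h \<in> carrier M \<rightarrow> carrier N.
     (\<forall>x\<in>carrier M. \<forall>y\<in>carrier M. h (x \<oplus>\<^bsub>M\<^esub> y) = h x \<oplus>\<^bsub>N\<^esub> h y) \<and>
     (\<forall>c\<in>carrier R. \<forall>x\<in>carrier M. h (c \<odot>\<^bsub>M\<^esub> x) = c \<odot>\<^bsub>N\<^esub> h x)}"

lemma lin_hom_closed: "h \<in> lin_hom R M N \<Longrightarrow> x \<in> carrier M \<Longrightarrow> h x \<in> carrier N"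
  and lin_hom_add: "h \<in> lin_hom R M N \<Longrightarrow> x \<in> carrier M \<Longrightarrow> y \<in> carrier M \<Longrightarrow> h (x \<oplus>\<^bsub>M\<^esub> y) = h x \<oplus>\<^bsub>N\<^esub> h y"
  and lin_hom_smult: "h \<in> lin_hom R M N \<Longrightarrow> c \<in> carrier R \<Longrightarrow> x \<in> carrier M \<Longrightarrow> h (c \<odot>\<^bsub>M\<^esub> x) = c \<odot>\<^bsub>N\<^esub> h x"
  by (auto simp: lin_hom_def)

definition lin_mono :: "('r, 'z) ring_scheme \<Rightarrow> ('r, 'm) module \<Rightarrow> ('r, 'n) module \<Rightarrow> ('m \<Rightarrow> 'n) set" where
  "lin_mono R M N = {h \<in> lin_hom R M N. inj_on h (carrier M)}"

definition lin_epi :: "('r, 'z) ring_scheme \<Rightarrow> ('r, 'm) module \<Rightarrow> ('r, 'n) module \<Rightarrow> ('m \<Rightarrow> 'n) set" where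
  "lin_epi R M N = {h \<in> lin_hom R M N. h ` carrier M = carrier N}"

definition lin_iso :: "('r, 'z) ring_scheme \<Rightarrow> ('r, 'm) module \<Rightarrow> ('r, 'n) module \<Rightarrow> ('m \<Rightarrow> 'n) set" where
  "lin_iso R M N = {h \<in> lin_hom R M N. bij_betw h (carrier M) (carrier N)}"

definition lin_ker :: "('r, 'm) module \<Rightarrow> ('r, 'n) module \<Rightarrow> ('m \<Rightarrow> 'n) \<Rightarrow> 'm set" where
  "lin_ker M N h = {x \<in> carrier M. h x = \<zero>\<^bsub>N\<^esub>}"

definition quot_mod :: "('r, 'm) module \<Rightarrow> 'm set \<Rightarrow> ('r, 'm set) module" where
  "quot_mod M N = \<lparr>carrier = a_rcosets\<^bsub>M\<^esub> N, mult = undefined, one = undefined,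
     zero = N, add = set_add M,
     smult = (\<lambda>c X. \<Union>x\<in>X. N +>\<^bsub>M\<^esub> (c \<odot>\<^bsub>M\<^esub> x))\<rparr>"

text \<open>The map on quotients induced by a map \<^verbatim>\<open>h\<close> into \<^verbatim>\<open>M'\<close>: all the cosets in the union coincide
  when \<^verbatim>\<open>h\<close> maps the submodule divided out in the domain into \<^verbatim>\<open>N'\<close>.\<close>

definition quot_map :: "('r, 'n) module \<Rightarrow> 'n set \<Rightarrow> ('m \<Rightarrow> 'n) \<Rightarrow> 'm set \<Rightarrow> 'n set" where
  "quot_map M' N' h X = (\<Union>x\<in>X. N' +>\<^bsub>M'\<^esub> h x)"


section \<open>Diagrams indexed by the integers\<close>

text \<open>A diagram consists of modules \<^verbatim>\<open>M r\<close> and maps \<^verbatim>\<open>t r\<close> from \<^verbatim>\<open>M r\<close> to \<^verbatim>\<open>M (r + 1)\<close>.\<close>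

locale int_diagram =
  fixes R :: "('r, 'z) ring_scheme" and M :: "int \<Rightarrow> ('r, 'm) module" and t :: "int \<Rightarrow> 'm \<Rightarrow> 'm"
  assumes obj: "left_module R (M r)"
    and arr: "t r \<in> lin_hom R (M r) (M (r + 1))"

locale int_diagram_hom = dom: int_diagram R M t + cod: int_diagram R N u
  for R :: "('r, 'z) ring_scheme" and M :: "int \<Rightarrow> ('r, 'm) module" and t
    and N :: "int \<Rightarrow> ('r, 'n) module" and u +
  fixes f :: "int \<Rightarrow> 'm \<Rightarrow> 'n"
  assumes hom: "f r \<in> lin_hom R (M r) (N r)"
    and natural: "x \<in> carrier (M r) \<Longrightarrow> f (r + 1) (t r x) = u r (f r x)"

primrec steps :: "(int \<Rightarrow> 'm \<Rightarrow> 'm) \<Rightarrow> int \<Rightarrow> nat \<Rightarrow> 'm \<Rightarrow> 'm" where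
  "steps t r 0 x = x"
| "steps t r (Suc k) x = t (r + int k) (steps t r k x)"

subsection \<open>Colimits\<close>

text \<open>The colimit of the (directed) diagram is the set of germs, i.e. of pairs \<^verbatim>\<open>(r, x)\<close> with
  \<^verbatim>\<open>x\<close> in \<^verbatim>\<open>M r\<close> modulo becoming equal further on in the diagram.\<close>

definition germ_rel :: "(int \<Rightarrow> ('r, 'm) module) \<Rightarrow> (int \<Rightarrow> 'm \<Rightarrow> 'm) \<Rightarrow> ((int \<times> 'm) \<times> (int \<times> 'm)) set" where
  "germ_rel M t = {((r, x), (s, y)). x \<in> carrier (M r) \<and> y \<in> carrier (M s) \<and>
     (\<exists>k l. r + int k = s + int l \<and> steps t r k x = steps t s l y)}"

definition germ :: "(int \<Rightarrow> ('r, 'm) module) \<Rightarrow> (int \<Rightarrow> 'm \<Rightarrow> 'm) \<Rightarrow> int \<Rightarrow> 'm \<Rightarrow> (int \<times> 'm) set" where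
  "germ M t r x = germ_rel M t `` {(r, x)}"

text \<open>All members of the unions below coincide; see \<^verbatim>\<open>colim_add_germ\<close>, \<^verbatim>\<open>colim_smult_germ\<close>,
  \<^verbatim>\<open>colim_map_germ\<close>.\<close>

definition colim_mod :: "(int \<Rightarrow> ('r, 'm) module) \<Rightarrow> (int \<Rightarrow> 'm \<Rightarrow> 'm) \<Rightarrow> ('r, (int \<times> 'm) set) module" where
  "colim_mod M t = \<lparr>carrier = {germ M t r x |r x. x \<in> carrier (M r)},
     mult = undefined, one = undefined,
     zero = germ M t 0 \<zero>\<^bsub>M 0\<^esub>,
     add = (\<lambda>X Y. \<Union>{germ M t r (x \<oplus>\<^bsub>M r\<^esub> y) |r x y. (r, x) \<in> X \<and> (r, y) \<in> Y}),
     smult = (\<lambda>c X. \<Union>{germ M t r (c \<odot>\<^bsub>M r\<^esub> x) |r x. (r, x) \<in> X})\<rparr>"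

definition colim_map ::
  "(int \<Rightarrow> ('r, 'n) module) \<Rightarrow> (int \<Rightarrow> 'n \<Rightarrow> 'n) \<Rightarrow> (int \<Rightarrow> 'm \<Rightarrow> 'n) \<Rightarrow> (int \<times> 'm) set \<Rightarrow> (int \<times> 'n) set" where
  "colim_map N u f X = \<Union>{germ N u r (f r x) |r x. (r, x) \<in> X}"

context int_diagram
begin

lemma steps_closed: "x \<in> carrier (M r) \<Longrightarrow> steps t r k x \<in> carrier (M (r + int k))"
proof (induction k)
  case (Suc k)
  then show ?case using lin_hom_closed[OF arr, of "steps t r k x" "r + int k"] by (simp add: ac_simps)
qed simp

lemma steps_shift: "steps t (r + 1) k (t r x) = steps t r (Suc k) x"
proof (induction k)
  case (Suc k)
  then show ?case by (simp add: algebra_simps)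
qed simp

lemma steps_add: "steps t r (k + j) x = steps t (r + int k) j (steps t r k x)"
  by (induction j) (simp_all add: add.assoc)

lemma steps_hom: "steps t r k \<in> lin_hom R (M r) (M (r + int k))"
proof (induction k)
  case 0
  show ?case by (simp add: lin_hom_def)
next
  case (Suc k)
  have "t (r + int k) \<in> lin_hom R (M (r + int k)) (M (r + int (Suc k)))"
    using arr[of "r + int k"] by (simp add: ac_simps)
  from lin_hom_closed[OF Suc] lin_hom_add[OF Suc] lin_hom_smult[OF Suc]
    lin_hom_closed[OF this] lin_hom_add[OF this] lin_hom_smult[OF this]
  show ?case by (simp add: lin_hom_def)
qed

lemma equiv_germ_rel: "equiv (SIGMA r:UNIV. carrier (M r)) (germ_rel M t)"
proof (rule equivI)
  show "germ_rel M t \<subseteq> (SIGMA r:UNIV. carrier (M r)) \<times> (SIGMA r:UNIV. carrier (M r))"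
    by (auto simp: germ_rel_def)
  show "refl_on (SIGMA r:UNIV. carrier (M r)) (germ_rel M t)"
    by (auto simp: refl_on_def germ_rel_def intro: exI[of _ 0])
  show "sym (germ_rel M t)" unfolding sym_def germ_rel_def by clarsimp metis
  show "trans (germ_rel M t)"
  proof (rule transI, clarsimp simp: germ_rel_def)
    fix r x s y q z k l k' l'
    assume 1: "r + int k = s + int l" "steps t r k x = steps t s l y"
      and 2: "s + int k' = q + int l'" "steps t s k' y = steps t q l' z"
    have "steps t r (k + k') x = steps t s (l + k') y" by (simp add: steps_add 1)
    also have "\<dots> = steps t s (k' + l) y" by (simp add: add.commute)
    also have "\<dots> = steps t q (l' + l) z" by (simp add: steps_add 2)
    finally have "steps t r (k + k') x = steps t q (l' + l) z" .
    moreover have "r + int (k + k') = q + int (l' + l)" using 1(1) 2(1) by simp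
    ultimately show "\<exists>k l. r + int k = q + int l \<and> steps t r k x = steps t q l z" by blast
  qed
qed

lemma germ_eq_iff:
  assumes "x \<in> carrier (M r)" "y \<in> carrier (M s)"
  shows "germ M t r x = germ M t s y \<longleftrightarrow> (\<exists>k l. r + int k = s + int l \<and> steps t r k x = steps t s l y)"
  using eq_equiv_class_iff[OF equiv_germ_rel, of "(r, x)" "(s, y)"] assms
  by (simp add: germ_def germ_rel_def)

lemma mem_germ_iff:
  assumes "x \<in> carrier (M r)"
  shows "(s, y) \<in> germ M t r x \<longleftrightarrow> y \<in> carrier (M s) \<and> germ M t s y = germ M t r x"
proof (cases "y \<in> carrier (M s)")
  case True
  then show ?thesis
    using equiv_class_eq_iff[OF equiv_germ_rel, of "(r, x)" "(s, y)"] assms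
    by (auto simp: germ_def)
qed (simp add: germ_def germ_rel_def)

lemma germ_step: "x \<in> carrier (M r) \<Longrightarrow> germ M t (r + 1) (t r x) = germ M t r x"
  using lin_hom_closed[OF arr, of x r] germ_eq_iff[of "t r x" "r + 1" x r] steps_shift[of r 0 x]
  by (metis (no_types, opaque_lifting) add.right_neutral of_nat_0 of_nat_1 One_nat_def steps.simps(1))

lemma colim_add_germ:
  assumes x: "x \<in> carrier (M r)" and y: "y \<in> carrier (M r)"
  shows "germ M t r x \<oplus>\<^bsub>colim_mod M t\<^esub> germ M t r y = germ M t r (x \<oplus>\<^bsub>M r\<^esub> y)"
proof -
  interpret M: left_module R "M q" for q by (rule obj)
  have eq: "germ M t s (x' \<oplus>\<^bsub>M s\<^esub> y') = germ M t r (x \<oplus>\<^bsub>M r\<^esub> y)"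
    if m: "(s, x') \<in> germ M t r x" "(s, y') \<in> germ M t r y" for s x' y'
  proof -
    have c: "x' \<in> carrier (M s)" "y' \<in> carrier (M s)" using m mem_germ_iff[OF x, of s x'] mem_germ_iff[OF y, of s y'] by simp_all
    obtain k l where 1: "s + int k = r + int l" "steps t s k x' = steps t r l x"
      using m(1) mem_germ_iff[OF x, of s x'] germ_eq_iff[OF c(1) x] by blast
    obtain k' l' where 2: "s + int k' = r + int l'" "steps t s k' y' = steps t r l' y"
      using m(2) mem_germ_iff[OF y, of s y'] germ_eq_iff[OF c(2) y] by blast
    have a: "k' + k = k + k'" "l' + k = l + k'" using 1(1) 2(1) by auto
    have 3: "steps t s (k + k') x' = steps t r (l + k') x" by (simp add: steps_add 1)
    have "steps t s (k' + k) y' = steps t r (l' + k) y" by (simp add: steps_add 2)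
    then have 4: "steps t s (k + k') y' = steps t r (l + k') y" unfolding a .
    have 5: "s + int (k + k') = r + int (l + k')" using 1(1) by simp
    have "steps t s (k + k') (x' \<oplus>\<^bsub>M s\<^esub> y') = steps t r (l + k') (x \<oplus>\<^bsub>M r\<^esub> y)"
      unfolding lin_hom_add[OF steps_hom c] lin_hom_add[OF steps_hom x y] 3 4 5 ..
    then show ?thesis using 5 germ_eq_iff c x y M.M.add.m_closed by blast
  qed
  have "{germ M t s (x' \<oplus>\<^bsub>M s\<^esub> y') |s x' y'. (s, x') \<in> germ M t r x \<and> (s, y') \<in> germ M t r y}
      = {germ M t r (x \<oplus>\<^bsub>M r\<^esub> y)}"
    using eq mem_germ_iff[OF x, of r x] mem_germ_iff[OF y, of r y] x y
    by (intro equalityI subsetI) blast+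
  then show ?thesis by (simp add: colim_mod_def)
qed

lemma colim_smult_germ:
  assumes c: "c \<in> carrier R" and x: "x \<in> carrier (M r)"
  shows "c \<odot>\<^bsub>colim_mod M t\<^esub> germ M t r x = germ M t r (c \<odot>\<^bsub>M r\<^esub> x)"
proof -
  interpret M: left_module R "M q" for q by (rule obj)
  have eq: "germ M t s (c \<odot>\<^bsub>M s\<^esub> x') = germ M t r (c \<odot>\<^bsub>M r\<^esub> x)" if m: "(s, x') \<in> germ M t r x" for s x'
  proof -
    have c': "x' \<in> carrier (M s)" using m mem_germ_iff[OF x, of s x'] by simp
    obtain k l where 1: "s + int k = r + int l" "steps t s k x' = steps t r l x"
      using m mem_germ_iff[OF x, of s x'] germ_eq_iff[OF c' x] by blast
    have "steps t s k (c \<odot>\<^bsub>M s\<^esub> x') = steps t r l (c \<odot>\<^bsub>M r\<^esub> x)"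
      unfolding lin_hom_smult[OF steps_hom c c'] lin_hom_smult[OF steps_hom c x] 1 ..
    then show ?thesis using 1(1) germ_eq_iff c c' x M.smult_closed by blast
  qed
  have "{germ M t s (c \<odot>\<^bsub>M s\<^esub> x') |s x'. (s, x') \<in> germ M t r x} = {germ M t r (c \<odot>\<^bsub>M r\<^esub> x)}"
    using eq mem_germ_iff[OF x, of r x] x by (intro equalityI subsetI) blast+
  then show ?thesis by (simp add: colim_mod_def)
qed

end

context int_diagram_hom
begin

lemma steps_natural: "x \<in> carrier (M r) \<Longrightarrow> f (r + int k) (steps t r k x) = steps u r k (f r x)"
proof (induction k)
  case (Suc k)
  then show ?case using natural[OF dom.steps_closed[OF Suc.prems, of k]] by (simp add: ac_simps)
qed simp

lemma colim_map_germ: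
  assumes x: "x \<in> carrier (M r)"
  shows "colim_map N u f (germ M t r x) = germ N u r (f r x)"
proof -
  have eq: "germ N u s (f s x') = germ N u r (f r x)" if m: "(s, x') \<in> germ M t r x" for s x'
  proof -
    have c: "x' \<in> carrier (M s)" using m dom.mem_germ_iff[OF x] by auto
    obtain k l where 1: "s + int k = r + int l" "steps t s k x' = steps t r l x"
      using m dom.mem_germ_iff[OF x] dom.germ_eq_iff[OF c x] by auto
    have "steps u s k (f s x') = steps u r l (f r x)"
      unfolding steps_natural[OF c, symmetric] steps_natural[OF x, symmetric] 1 ..
    then show ?thesis using 1(1) cod.germ_eq_iff lin_hom_closed[OF hom c] lin_hom_closed[OF hom x] by blast
  qed
  have "{germ N u s (f s x') |s x'. (s, x') \<in> germ M t r x} = {germ N u r (f r x)}"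
    using eq dom.mem_germ_iff[OF x, of r x] x by (intro equalityI subsetI) blast+
  then show ?thesis by (simp add: colim_map_def)
qed

end

subsection \<open>The limit and its first derived functor\<close>

definition prod_mod :: "(int \<Rightarrow> ('r, 'm) module) \<Rightarrow> ('r, int \<Rightarrow> 'm) module" where
  "prod_mod M = \<lparr>carrier = {s. \<forall>r. s r \<in> carrier (M r)}, mult = undefined, one = undefined,
     zero = (\<lambda>r. \<zero>\<^bsub>M r\<^esub>), add = (\<lambda>s s' r. s r \<oplus>\<^bsub>M r\<^esub> s' r),
     smult = (\<lambda>c s r. c \<odot>\<^bsub>M r\<^esub> s r)\<rparr>"

definition prod_map :: "(int \<Rightarrow> 'm \<Rightarrow> 'n) \<Rightarrow> (int \<Rightarrow> 'm) \<Rightarrow> (int \<Rightarrow> 'n)" where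
  "prod_map f s = (\<lambda>r. f r (s r))"

definition lim_mod :: "(int \<Rightarrow> ('r, 'm) module) \<Rightarrow> (int \<Rightarrow> 'm \<Rightarrow> 'm) \<Rightarrow> ('r, int \<Rightarrow> 'm) module" where
  "lim_mod M t = (prod_mod M)\<lparr>carrier := {s \<in> carrier (prod_mod M). \<forall>r. t r (s r) = s (r + 1)}\<rparr>"

definition shift_diff :: "(int \<Rightarrow> ('r, 'm) module) \<Rightarrow> (int \<Rightarrow> 'm \<Rightarrow> 'm) \<Rightarrow> (int \<Rightarrow> 'm) \<Rightarrow> (int \<Rightarrow> 'm)" where
  "shift_diff M t s = (\<lambda>r. s r \<ominus>\<^bsub>M r\<^esub> t (r - 1) (s (r - 1)))"

text \<open>The first derived functor of the limit is taken in its standard (Milnor) form: the limit is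
  the kernel of \<^verbatim>\<open>shift_diff\<close>, and its derived functor is the cokernel.  That this is the first right
  derived functor, computed from any embedding into an injective diagram, is proved in
  \<^verbatim>\<open>lim1_injective\<close> and \<^verbatim>\<open>lim1_dimension_shift\<close>.\<close>

definition lim1_mod :: "(int \<Rightarrow> ('r, 'm) module) \<Rightarrow> (int \<Rightarrow> 'm \<Rightarrow> 'm) \<Rightarrow> ('r, (int \<Rightarrow> 'm) set) module" where
  "lim1_mod M t = quot_mod (prod_mod M) (shift_diff M t ` carrier (prod_mod M))"

definition lim1_map ::
  "(int \<Rightarrow> ('r, 'n) module) \<Rightarrow> (int \<Rightarrow> 'n \<Rightarrow> 'n) \<Rightarrow> (int \<Rightarrow> 'm \<Rightarrow> 'n)
    \<Rightarrow> (int \<Rightarrow> 'm) set \<Rightarrow> (int \<Rightarrow> 'n) set" where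
  "lim1_map N u f = quot_map (prod_mod N) (shift_diff N u ` carrier (prod_mod N)) (prod_map f)"

lemma lin_hom_zero:
  assumes "left_module R M" "left_module R N" "h \<in> lin_hom R M N"
  shows "h \<zero>\<^bsub>M\<^esub> = \<zero>\<^bsub>N\<^esub>"
proof -
  interpret M: left_module R M by fact
  interpret N: left_module R N by fact
  have "h \<zero>\<^bsub>M\<^esub> \<oplus>\<^bsub>N\<^esub> h \<zero>\<^bsub>M\<^esub> = h \<zero>\<^bsub>M\<^esub>"
    using lin_hom_add[OF assms(3), of "\<zero>\<^bsub>M\<^esub>" "\<zero>\<^bsub>M\<^esub>"] by simp
  then show ?thesis
    using lin_hom_closed[OF assms(3), of "\<zero>\<^bsub>M\<^esub>"] by (metis M.M.zero_closed N.M.add.r_cancel_one')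
qed

lemma lin_hom_minus:
  assumes "left_module R M" "left_module R N" "h \<in> lin_hom R M N" "x \<in> carrier M" "y \<in> carrier M"
  shows "h (x \<ominus>\<^bsub>M\<^esub> y) = h x \<ominus>\<^bsub>N\<^esub> h y"
proof -
  interpret M: left_module R M by fact
  interpret N: left_module R N by fact
  have "h (x \<ominus>\<^bsub>M\<^esub> y) \<oplus>\<^bsub>N\<^esub> h y = h x"
    using lin_hom_add[OF assms(3), of "x \<ominus>\<^bsub>M\<^esub> y" y] assms(4,5)
    by (simp add: M.M.minus_eq M.M.a_assoc M.M.l_neg)
  moreover have "h x \<in> carrier N" "h y \<in> carrier N" "h (x \<ominus>\<^bsub>M\<^esub> y) \<in> carrier N"
    using lin_hom_closed[OF assms(3)] assms(4,5) by auto
  ultimately show ?thesis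
    by (metis N.M.add.inv_closed N.M.add.m_assoc N.M.minus_eq N.M.r_neg N.M.r_zero)
qed

lemma (in left_module) smult_zero: "c \<in> carrier R \<Longrightarrow> c \<odot>\<^bsub>M\<^esub> \<zero>\<^bsub>M\<^esub> = \<zero>\<^bsub>M\<^esub>"
  by (metis M.add.r_cancel_one' M.l_zero M.zero_closed smult_closed smult_r_distr)

lemma (in left_module) smult_minus:
  assumes "c \<in> carrier R" "x \<in> carrier M" "y \<in> carrier M"
  shows "c \<odot>\<^bsub>M\<^esub> (x \<ominus>\<^bsub>M\<^esub> y) = c \<odot>\<^bsub>M\<^esub> x \<ominus>\<^bsub>M\<^esub> c \<odot>\<^bsub>M\<^esub> y"
proof -
  have "c \<odot>\<^bsub>M\<^esub> (x \<ominus>\<^bsub>M\<^esub> y) \<oplus>\<^bsub>M\<^esub> c \<odot>\<^bsub>M\<^esub> y = c \<odot>\<^bsub>M\<^esub> x"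
    using smult_r_distr[of c "x \<ominus>\<^bsub>M\<^esub> y" y] assms by (simp add: M.minus_eq M.a_assoc M.l_neg)
  then show ?thesis using assms
    by (metis M.add.inv_closed M.add.m_assoc M.minus_eq M.r_neg M.r_zero M.minus_closed smult_closed)
qed

lemma (in left_module) minus_zero_iff:
  assumes "x \<in> carrier M" "y \<in> carrier M"
  shows "x \<ominus>\<^bsub>M\<^esub> y = \<zero>\<^bsub>M\<^esub> \<longleftrightarrow> x = y"
  using assms by (metis M.add.inv_closed M.add.inv_inv M.minus_equality M.minus_eq M.r_neg)

lemma (in left_module) coset_eq_iff:
  assumes N: "subgroup N (add_monoid M)" and x: "x \<in> carrier M" and y: "y \<in> carrier M"
  shows "N +>\<^bsub>M\<^esub> x = N +>\<^bsub>M\<^esub> y \<longleftrightarrow> x \<ominus>\<^bsub>M\<^esub> y \<in> N"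
proof -
  have sub: "N \<subseteq> carrier M" using subgroup.subset[OF N] by simp
  have mem: "x \<in> N +>\<^bsub>M\<^esub> y \<longleftrightarrow> x \<ominus>\<^bsub>M\<^esub> y \<in> N"
  proof
    assume "x \<in> N +>\<^bsub>M\<^esub> y"
    then obtain h where h: "h \<in> N" "x = h \<oplus>\<^bsub>M\<^esub> y" by (auto simp: a_r_coset_def r_coset_def)
    then have "x \<ominus>\<^bsub>M\<^esub> y = h" using subsetD[OF sub h(1)] y
      by (simp add: M.minus_eq M.a_assoc M.r_neg)
    then show "x \<ominus>\<^bsub>M\<^esub> y \<in> N" using h by simp
  next
    assume "x \<ominus>\<^bsub>M\<^esub> y \<in> N"
    moreover have "x = (x \<ominus>\<^bsub>M\<^esub> y) \<oplus>\<^bsub>M\<^esub> y"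
      using x y by (simp add: M.minus_eq M.a_assoc M.l_neg)
    ultimately show "x \<in> N +>\<^bsub>M\<^esub> y" unfolding a_r_coset_def r_coset_def by auto
  qed
  then show ?thesis
    using M.a_repr_independence[OF _ y N, of x] M.add.rcos_self[OF x N, folded a_r_coset_def] by metis
qed

lemma (in left_module) quot_smult:
  assumes N: "subgroup N (add_monoid M)" and NR: "\<And>c x. c \<in> carrier R \<Longrightarrow> x \<in> N \<Longrightarrow> c \<odot>\<^bsub>M\<^esub> x \<in> N"
    and c: "c \<in> carrier R" and x: "x \<in> carrier M"
  shows "c \<odot>\<^bsub>quot_mod M N\<^esub> (N +>\<^bsub>M\<^esub> x) = N +>\<^bsub>M\<^esub> (c \<odot>\<^bsub>M\<^esub> x)"
proof -
  have sub: "N \<subseteq> carrier M" using subgroup.subset[OF N] by simp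
  have eq: "N +>\<^bsub>M\<^esub> (c \<odot>\<^bsub>M\<^esub> y) = N +>\<^bsub>M\<^esub> (c \<odot>\<^bsub>M\<^esub> x)" if y: "y \<in> N +>\<^bsub>M\<^esub> x" for y
  proof -
    have y': "y \<in> carrier M" by (rule subsetD[OF M.a_r_coset_subset_G[OF sub x] y])
    have "N +>\<^bsub>M\<^esub> y = N +>\<^bsub>M\<^esub> x" by (rule M.a_repr_independence[OF y x N, symmetric])
    then have "y \<ominus>\<^bsub>M\<^esub> x \<in> N" unfolding coset_eq_iff[OF N y' x] .
    from NR[OF c this] show ?thesis
      unfolding coset_eq_iff[OF N smult_closed[OF c y'] smult_closed[OF c x]] smult_minus[OF c y' x] .
  qed
  have ne: "N +>\<^bsub>M\<^esub> x \<noteq> {}" using M.add.rcos_self[OF x N, folded a_r_coset_def] by blast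
  have "(\<Union>y\<in>N +>\<^bsub>M\<^esub> x. N +>\<^bsub>M\<^esub> (c \<odot>\<^bsub>M\<^esub> y)) = N +>\<^bsub>M\<^esub> (c \<odot>\<^bsub>M\<^esub> x)"
    by (rule SUP_eq_const[OF ne eq])
  then show ?thesis by (simp add: quot_mod_def)
qed

lemma (in left_module) quot_add:
  assumes N: "subgroup N (add_monoid M)" and x: "x \<in> carrier M" and y: "y \<in> carrier M"
  shows "(N +>\<^bsub>M\<^esub> x) \<oplus>\<^bsub>quot_mod M N\<^esub> (N +>\<^bsub>M\<^esub> y) = N +>\<^bsub>M\<^esub> (x \<oplus>\<^bsub>M\<^esub> y)"
proof -
  have "abelian_subgroup N M"
    by (intro abelian_subgroupI3 additive_subgroup.intro N M.abelian_group_axioms)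
  from abelian_subgroup.a_rcos_sum[OF this x y] show ?thesis by (simp add: quot_mod_def)
qed

lemma lin_hom_range_subgroup:
  assumes A: "left_module R A" and h: "h \<in> lin_hom R A A"
  shows "subgroup (h ` carrier A) (add_monoid A)"
proof -
  interpret A: left_module R A by fact
  show ?thesis
  proof (rule A.M.add.subgroupI)
    show "h ` carrier A \<subseteq> carrier A" using lin_hom_closed[OF h] by auto
    show "h ` carrier A \<noteq> {}" using A.M.zero_closed by blast
    fix a assume "a \<in> h ` carrier A"
    then obtain x where x: "x \<in> carrier A" "a = h x" by auto
    have "\<ominus>\<^bsub>A\<^esub> a = \<zero>\<^bsub>A\<^esub> \<ominus>\<^bsub>A\<^esub> a" using x lin_hom_closed[OF h] by (simp add: A.M.minus_eq)
    also have "\<dots> = h (\<zero>\<^bsub>A\<^esub> \<ominus>\<^bsub>A\<^esub> x)"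
      using x lin_hom_zero[OF A A h] by (simp add: lin_hom_minus[OF A A h])
    finally show "\<ominus>\<^bsub>A\<^esub> a \<in> h ` carrier A" using x by auto
  next
    fix a b assume "a \<in> h ` carrier A" "b \<in> h ` carrier A"
    then show "a \<oplus>\<^bsub>A\<^esub> b \<in> h ` carrier A"
      using lin_hom_add[OF h] by (metis (no_types, lifting) A.M.add.m_closed image_iff)
  qed
qed

lemma snake:
  assumes A: "left_module R A" and B: "left_module R B" and C: "left_module R C"
    and f: "f \<in> lin_mono R A B" and g: "g \<in> lin_epi R B C" and fg: "f ` carrier A = lin_ker B C g"
    and dA: "dA \<in> lin_hom R A A" and dB: "dB \<in> lin_hom R B B" and dC: "dC \<in> lin_hom R C C"
    and dfg: "\<And>x. x \<in> carrier A \<Longrightarrow> f (dA x) = dB (f x)" "\<And>y. y \<in> carrier B \<Longrightarrow> g (dB y) = dC (g y)"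
    and surj: "dB ` carrier B = carrier B"
  shows "\<exists>\<delta>. \<delta> \<in> lin_epi R (C\<lparr>carrier := lin_ker C C dC\<rparr>) (quot_mod A (dA ` carrier A)) \<and>
     lin_ker (C\<lparr>carrier := lin_ker C C dC\<rparr>) (quot_mod A (dA ` carrier A)) \<delta> = g ` lin_ker B B dB \<and>
     (\<forall>y\<in>carrier B. \<forall>m\<in>carrier A. f m = dB y \<longrightarrow> \<delta> (g y) = (dA ` carrier A) +>\<^bsub>A\<^esub> m)"
proof -
  interpret A: left_module R A by fact
  interpret B: left_module R B by fact
  interpret C: left_module R C by fact
  have fh: "f \<in> lin_hom R A B" and finj: "inj_on f (carrier A)" using f by (auto simp: lin_mono_def)
  have gh: "g \<in> lin_hom R B C" and gs: "g ` carrier B = carrier C" using g by (auto simp: lin_epi_def)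
  note clo = lin_hom_closed[OF fh] lin_hom_closed[OF gh] lin_hom_closed[OF dA] lin_hom_closed[OF dB]
    lin_hom_closed[OF dC]
  note zer = lin_hom_zero[OF A B fh] lin_hom_zero[OF B C gh] lin_hom_zero[OF A A dA]
    lin_hom_zero[OF B B dB] lin_hom_zero[OF C C dC]
  note mi = lin_hom_minus[OF A B fh] lin_hom_minus[OF B C gh] lin_hom_minus[OF A A dA]
    lin_hom_minus[OF B B dB] lin_hom_minus[OF C C dC]
  note ad = lin_hom_add[OF fh] lin_hom_add[OF gh] lin_hom_add[OF dA] lin_hom_add[OF dB]
    lin_hom_add[OF dC]
  note sm = lin_hom_smult[OF fh] lin_hom_smult[OF gh] lin_hom_smult[OF dA] lin_hom_smult[OF dB]
    lin_hom_smult[OF dC]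
  let ?N = "dA ` carrier A" and ?K = "lin_ker C C dC"
  let ?Q = "quot_mod A ?N"
  have minus_self: "x \<ominus>\<^bsub>A\<^esub> x = \<zero>\<^bsub>A\<^esub>" if "x \<in> carrier A" for x
    using that by (simp add: A.M.minus_eq A.M.r_neg)
  have N: "subgroup ?N (add_monoid A)" by (rule lin_hom_range_subgroup[OF A dA])
  have NR: "c \<odot>\<^bsub>A\<^esub> x \<in> ?N" if "c \<in> carrier R" "x \<in> ?N" for c x
    using that sm(3) by (metis (no_types, lifting) A.smult_closed image_iff)
  have N0: "?N +>\<^bsub>A\<^esub> \<zero>\<^bsub>A\<^esub> = ?N" using clo by (intro A.M.a_coset_add_zero) auto
  define \<delta> where "\<delta> q = \<Union>{?N +>\<^bsub>A\<^esub> m |m y. m \<in> carrier A \<and> y \<in> carrier B \<and> g y = q \<and> f m = dB y}" for q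
  have uniq: "?N +>\<^bsub>A\<^esub> m = ?N +>\<^bsub>A\<^esub> m'"
    if "m \<in> carrier A" "y \<in> carrier B" "f m = dB y" "m' \<in> carrier A" "y' \<in> carrier B" "f m' = dB y'" "g y = g y'"
    for m y m' y'
  proof -
    have "y \<ominus>\<^bsub>B\<^esub> y' \<in> lin_ker B C g"
      using that clo by (simp add: lin_ker_def mi C.M.minus_eq C.M.r_neg)
    then obtain a where a: "a \<in> carrier A" "f a = y \<ominus>\<^bsub>B\<^esub> y'" using fg by (metis imageE)
    have "f (m \<ominus>\<^bsub>A\<^esub> m') = f (dA a)" using that a dfg by (simp add: mi)
    then have "m \<ominus>\<^bsub>A\<^esub> m' = dA a" using finj that a clo by (auto dest!: inj_onD)
    then show ?thesis using A.coset_eq_iff[OF N] that a by auto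
  qed
  have d: "\<delta> (g y) = ?N +>\<^bsub>A\<^esub> m" if "m \<in> carrier A" "y \<in> carrier B" "f m = dB y" for m y
  proof -
    have "{?N +>\<^bsub>A\<^esub> m' |m' y'. m' \<in> carrier A \<and> y' \<in> carrier B \<and> g y' = g y \<and> f m' = dB y'} = {?N +>\<^bsub>A\<^esub> m}"
      using that uniq by (intro equalityI subsetI) blast+
    then show ?thesis unfolding \<delta>_def by simp
  qed
  have rep: "\<exists>m\<in>carrier A. \<exists>y\<in>carrier B. g y = q \<and> f m = dB y" if "q \<in> ?K" for q
  proof -
    have "q \<in> g ` carrier B" using that gs by (simp add: lin_ker_def)
    then obtain y where y: "y \<in> carrier B" "g y = q" by auto
    have "dB y \<in> lin_ker B C g" using y that dfg clo by (auto simp: lin_ker_def)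
    then show ?thesis using y fg by (metis imageE)
  qed
  have inK: "g y \<in> ?K" if "m \<in> carrier A" "y \<in> carrier B" "f m = dB y" for m y
  proof -
    have "f m \<in> lin_ker B C g" using that fg by blast
    then show ?thesis using that dfg clo by (auto simp: lin_ker_def)
  qed
  have hom: "\<delta> \<in> lin_hom R (C\<lparr>carrier := ?K\<rparr>) ?Q"
    unfolding lin_hom_def
  proof (intro CollectI conjI ballI funcsetI)
    fix q assume "q \<in> carrier (C\<lparr>carrier := ?K\<rparr>)"
    then have "q \<in> ?K" by simp
    then obtain m y where "m \<in> carrier A" "y \<in> carrier B" "g y = q" "f m = dB y" using rep by blast
    moreover have "?N \<subseteq> carrier A" using clo by auto
    ultimately show "\<delta> q \<in> carrier ?Q" using d A.M.a_rcosetsI[of ?N m] by (auto simp: quot_mod_def)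
  next
    fix q q' assume "q \<in> carrier (C\<lparr>carrier := ?K\<rparr>)" "q' \<in> carrier (C\<lparr>carrier := ?K\<rparr>)"
    then have "q \<in> ?K" "q' \<in> ?K" by simp_all
    then obtain m y m' y' where *: "m \<in> carrier A" "y \<in> carrier B" "g y = q" "f m = dB y"
      "m' \<in> carrier A" "y' \<in> carrier B" "g y' = q'" "f m' = dB y'" using rep by meson
    have "\<delta> (g (y \<oplus>\<^bsub>B\<^esub> y')) = ?N +>\<^bsub>A\<^esub> (m \<oplus>\<^bsub>A\<^esub> m')"
      using * by (intro d) (auto simp: ad)
    then show "\<delta> (q \<oplus>\<^bsub>C\<lparr>carrier := ?K\<rparr>\<^esub> q') = \<delta> q \<oplus>\<^bsub>?Q\<^esub> \<delta> q'"
      using * d[of m y] d[of m' y'] A.quot_add[OF N, of m m'] by (simp add: ad)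
  next
    fix c q assume c: "c \<in> carrier R" and "q \<in> carrier (C\<lparr>carrier := ?K\<rparr>)"
    then have "q \<in> ?K" by simp
    then obtain m y where *: "m \<in> carrier A" "y \<in> carrier B" "g y = q" "f m = dB y" using rep by blast
    have "\<delta> (g (c \<odot>\<^bsub>B\<^esub> y)) = ?N +>\<^bsub>A\<^esub> (c \<odot>\<^bsub>A\<^esub> m)"
      using * c by (intro d) (auto simp: sm)
    then show "\<delta> (c \<odot>\<^bsub>C\<lparr>carrier := ?K\<rparr>\<^esub> q) = c \<odot>\<^bsub>?Q\<^esub> \<delta> q"
      using * c d[of m y] A.quot_smult[OF N NR, of c m] by (simp add: sm)
  qed
  have onto: "\<delta> ` ?K = carrier ?Q"
  proof
    show "\<delta> ` ?K \<subseteq> carrier ?Q" using lin_hom_closed[OF hom] by auto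
    show "carrier ?Q \<subseteq> \<delta> ` ?K"
    proof
      fix Y assume "Y \<in> carrier ?Q"
      then obtain m where m: "m \<in> carrier A" "Y = ?N +>\<^bsub>A\<^esub> m"
        by (auto simp: quot_mod_def A_RCOSETS_def RCOSETS_def a_r_coset_def)
      obtain y where "y \<in> carrier B" "f m = dB y" using surj clo(1)[OF m(1)] by (metis imageE)
      then show "Y \<in> \<delta> ` ?K" using m d[of m y] inK[of m y] by auto
    qed
  qed
  have ker: "lin_ker (C\<lparr>carrier := ?K\<rparr>) ?Q \<delta> = g ` lin_ker B B dB"
  proof
    show "lin_ker (C\<lparr>carrier := ?K\<rparr>) ?Q \<delta> \<subseteq> g ` lin_ker B B dB"
    proof
      fix q assume q: "q \<in> lin_ker (C\<lparr>carrier := ?K\<rparr>) ?Q \<delta>"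
      then have "q \<in> ?K" by (simp add: lin_ker_def[of "C\<lparr>carrier := ?K\<rparr>"])
      then obtain m y where *: "m \<in> carrier A" "y \<in> carrier B" "g y = q" "f m = dB y"
        using rep by blast
      have "?N +>\<^bsub>A\<^esub> m = ?N +>\<^bsub>A\<^esub> \<zero>\<^bsub>A\<^esub>"
        using q d[of m y] * by (simp add: lin_ker_def quot_mod_def N0)
      then have "m \<ominus>\<^bsub>A\<^esub> \<zero>\<^bsub>A\<^esub> \<in> ?N" using A.coset_eq_iff[OF N *(1)] by simp
      moreover have "m \<ominus>\<^bsub>A\<^esub> \<zero>\<^bsub>A\<^esub> = m"
        using *(1) by (simp add: A.M.minus_eq)
      ultimately obtain a where a: "a \<in> carrier A" "m = dA a" by auto
      have "f a \<in> lin_ker B C g" using a fg by auto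
      then have "g (y \<ominus>\<^bsub>B\<^esub> f a) = q" using * a clo by (auto simp: mi lin_ker_def C.M.minus_eq)
      moreover have "y \<ominus>\<^bsub>B\<^esub> f a \<in> lin_ker B B dB"
      proof -
        have fa: "f a \<in> carrier B" "dB (f a) = dB y" using * a clo dfg(1)[OF a(1)] by auto
        have "dB (y \<ominus>\<^bsub>B\<^esub> f a) = dB y \<ominus>\<^bsub>B\<^esub> dB y" unfolding mi(4)[OF *(2) fa(1)] fa(2) ..
        also have "\<dots> = \<zero>\<^bsub>B\<^esub>" using B.minus_zero_iff[of "dB y" "dB y"] clo *(2) by blast
        finally show ?thesis using fa *(2) by (simp add: lin_ker_def)
      qed
      ultimately show "q \<in> g ` lin_ker B B dB" by blast
    qed
    show "g ` lin_ker B B dB \<subseteq> lin_ker (C\<lparr>carrier := ?K\<rparr>) ?Q \<delta>"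
    proof
      fix q assume "q \<in> g ` lin_ker B B dB"
      then obtain y where y: "y \<in> carrier B" "dB y = \<zero>\<^bsub>B\<^esub>" "q = g y" by (auto simp: lin_ker_def)
      have "\<delta> q = ?N" using d[of "\<zero>\<^bsub>A\<^esub>" y] y N0 zer by simp
      moreover have "q \<in> ?K" using inK[of "\<zero>\<^bsub>A\<^esub>" y] y zer by simp
      ultimately show "q \<in> lin_ker (C\<lparr>carrier := ?K\<rparr>) ?Q \<delta>"
        by (simp add: lin_ker_def[of "C\<lparr>carrier := ?K\<rparr>"]) (simp add: quot_mod_def)
    qed
  qed
  have "\<delta> \<in> lin_epi R (C\<lparr>carrier := ?K\<rparr>) ?Q" using hom onto by (simp add: lin_epi_def)
  then show ?thesis using ker d by blast
qed

lemma left_module_prod: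
  assumes "\<And>r. left_module R (M r)"
  shows "left_module R (prod_mod M)"
proof -
  interpret R: ring R using assms left_module_def by blast
  have ab: "abelian_group (M r)" for r using assms[of r] left_module_def by blast
  interpret A: abelian_group "M r" for r by (rule ab)
  have "abelian_group (prod_mod M)"
  proof (rule abelian_groupI)
    fix s assume s: "s \<in> carrier (prod_mod M)"
    show "\<exists>y\<in>carrier (prod_mod M). y \<oplus>\<^bsub>prod_mod M\<^esub> s = \<zero>\<^bsub>prod_mod M\<^esub>"
      using s by (intro bexI[of _ "\<lambda>r. \<ominus>\<^bsub>M r\<^esub> s r"])
        (auto simp: prod_mod_def A.l_neg)
  qed (auto simp: prod_mod_def A.a_ac fun_eq_iff)
  then show ?thesis
    by (intro left_module.intro R.ring_axioms left_module_axioms.intro)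
      (auto simp: prod_mod_def fun_eq_iff left_module.smult_closed[OF assms]
        left_module.smult_l_distr[OF assms] left_module.smult_r_distr[OF assms]
        left_module.smult_assoc1[OF assms] left_module.smult_one[OF assms])
qed

lemma prod_map_hom:
  assumes "\<And>r. f r \<in> lin_hom R (M r) (N r)"
  shows "prod_map f \<in> lin_hom R (prod_mod M) (prod_mod N)"
  using lin_hom_closed[OF assms] lin_hom_add[OF assms] lin_hom_smult[OF assms]
  by (auto simp: lin_hom_def prod_mod_def prod_map_def)

context int_diagram
begin

lemma step_closed: "s \<in> carrier (prod_mod M) \<Longrightarrow> t (r - 1) (s (r - 1)) \<in> carrier (M r)"
  using lin_hom_closed[OF arr, of "s (r - 1)" "r - 1"] by (auto simp: prod_mod_def)

lemma shift_diff_hom: "shift_diff M t \<in> lin_hom R (prod_mod M) (prod_mod M)"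
proof -
  interpret M: left_module R "M r" for r by (rule obj)
  have *: "t (r - 1) (s (r - 1) \<oplus>\<^bsub>M (r - 1)\<^esub> s' (r - 1)) = t (r - 1) (s (r - 1)) \<oplus>\<^bsub>M r\<^esub> t (r - 1) (s' (r - 1))"
    if "s \<in> carrier (prod_mod M)" "s' \<in> carrier (prod_mod M)" for s s' r
    using that lin_hom_add[OF arr, of "s (r - 1)" "r - 1" "s' (r - 1)"] by (auto simp: prod_mod_def)
  have **: "t (r - 1) (c \<odot>\<^bsub>M (r - 1)\<^esub> s (r - 1)) = c \<odot>\<^bsub>M r\<^esub> t (r - 1) (s (r - 1))"
    if "s \<in> carrier (prod_mod M)" "c \<in> carrier R" for s c r
    using that lin_hom_smult[OF arr, of c "s (r - 1)" "r - 1"] by (auto simp: prod_mod_def)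
  have P: "s r \<in> carrier (M r)" if "s \<in> carrier (prod_mod M)" for s r using that by (auto simp: prod_mod_def)
  show ?thesis
    unfolding lin_hom_def
  proof (intro CollectI conjI ballI funcsetI)
    fix s assume s: "s \<in> carrier (prod_mod M)"
    show "shift_diff M t s \<in> carrier (prod_mod M)"
      using P[OF s] step_closed[OF s] by (auto simp: prod_mod_def shift_diff_def)
  next
    fix s s' assume s: "s \<in> carrier (prod_mod M)" and s': "s' \<in> carrier (prod_mod M)"
    show "shift_diff M t (s \<oplus>\<^bsub>prod_mod M\<^esub> s') = shift_diff M t s \<oplus>\<^bsub>prod_mod M\<^esub> shift_diff M t s'"
      using P[OF s] P[OF s'] step_closed[OF s] step_closed[OF s'] *[OF s s']
      by (simp add: fun_eq_iff shift_diff_def prod_mod_def M.M.minus_eq M.M.minus_add M.M.a_ac)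
  next
    fix c s assume c: "c \<in> carrier R" and s: "s \<in> carrier (prod_mod M)"
    show "shift_diff M t (c \<odot>\<^bsub>prod_mod M\<^esub> s) = c \<odot>\<^bsub>prod_mod M\<^esub> shift_diff M t s"
      using P[OF s] step_closed[OF s] **[OF s c] c
      by (simp add: fun_eq_iff shift_diff_def prod_mod_def M.smult_minus)
  qed
qed

lemma lim_eq_ker: "carrier (lim_mod M t) = lin_ker (prod_mod M) (prod_mod M) (shift_diff M t)"
proof -
  interpret M: left_module R "M r" for r by (rule obj)
  have "(\<forall>r. t r (s r) = s (r + 1)) \<longleftrightarrow> shift_diff M t s = \<zero>\<^bsub>prod_mod M\<^esub>" if s: "s \<in> carrier (prod_mod M)" for s
  proof -
    have "(\<forall>r. t r (s r) = s (r + 1)) \<longleftrightarrow> (\<forall>r. t (r - 1) (s (r - 1)) = s r)"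
      by (metis add_diff_cancel_right' diff_add_cancel)
    also have "\<dots> \<longleftrightarrow> (\<forall>r. s r \<ominus>\<^bsub>M r\<^esub> t (r - 1) (s (r - 1)) = \<zero>\<^bsub>M r\<^esub>)"
    proof -
      have "s r \<in> carrier (M r)" "t (r - 1) (s (r - 1)) \<in> carrier (M r)" for r
        using s step_closed[OF s] by (auto simp: prod_mod_def)
      then show ?thesis by (metis M.minus_zero_iff)
    qed
    finally show ?thesis by (simp add: shift_diff_def prod_mod_def fun_eq_iff)
  qed
  then show ?thesis by (auto simp: lim_mod_def lin_ker_def)
qed

lemma shift_diff_range_subgroup: "subgroup (shift_diff M t ` carrier (prod_mod M)) (add_monoid (prod_mod M))"
  by (rule lin_hom_range_subgroup[OF left_module_prod[OF obj] shift_diff_hom])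

lemma lim1_trivial_iff:
  "carrier (lim1_mod M t) = {\<zero>\<^bsub>lim1_mod M t\<^esub>}
    \<longleftrightarrow> shift_diff M t ` carrier (prod_mod M) = carrier (prod_mod M)" (is "_ \<longleftrightarrow> ?N = ?P")
proof -
  interpret P: left_module R "prod_mod M" by (rule left_module_prod[OF obj])
  have sub: "?N \<subseteq> ?P" using lin_hom_closed[OF shift_diff_hom] by auto
  note N = shift_diff_range_subgroup
  have car: "carrier (lim1_mod M t) = {?N +>\<^bsub>prod_mod M\<^esub> x |x. x \<in> ?P}"
    by (auto simp: lim1_mod_def quot_mod_def A_RCOSETS_def RCOSETS_def a_r_coset_def)
  have zero: "\<zero>\<^bsub>lim1_mod M t\<^esub> = ?N" by (simp add: lim1_mod_def quot_mod_def)
  have mem: "?N +>\<^bsub>prod_mod M\<^esub> x = ?N \<longleftrightarrow> x \<in> ?N" if "x \<in> ?P" for x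
    using P.M.a_coset_join1[OF _ that N] P.M.a_coset_join2[OF that N] by blast
  show ?thesis
    unfolding car zero
  proof
    assume *: "{?N +>\<^bsub>prod_mod M\<^esub> x |x. x \<in> ?P} = {?N}"
    have "x \<in> ?N" if "x \<in> ?P" for x
    proof -
      have "?N +>\<^bsub>prod_mod M\<^esub> x \<in> {?N}" unfolding *[symmetric] using that by blast
      then show ?thesis using mem[OF that] by simp
    qed
    then show "?N = ?P" using sub by blast
  next
    assume *: "?N = ?P"
    show "{?N +>\<^bsub>prod_mod M\<^esub> x |x. x \<in> ?P} = {?N}"
    proof (intro equalityI subsetI)
      fix Y assume "Y \<in> {?N +>\<^bsub>prod_mod M\<^esub> x |x. x \<in> ?P}"
      then obtain x where "x \<in> ?P" "Y = ?N +>\<^bsub>prod_mod M\<^esub> x" by blast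
      then show "Y \<in> {?N}" using mem[of x] * by simp
    next
      fix Y assume "Y \<in> {?N}"
      then have "Y = ?N +>\<^bsub>prod_mod M\<^esub> \<zero>\<^bsub>prod_mod M\<^esub>"
        using mem[OF P.M.zero_closed] * by simp
      then show "Y \<in> {?N +>\<^bsub>prod_mod M\<^esub> x |x. x \<in> ?P}" using P.M.zero_closed by blast
    qed
  qed
qed

end

theorem lim1_dimension_shift:
  assumes f: "int_diagram_hom R M t I u f" and g: "int_diagram_hom R I u Q v g"
    and inj: "\<And>r. inj_on (f r) (carrier (M r))"
    and surj: "\<And>r. g r ` carrier (I r) = carrier (Q r)"
    and exact: "\<And>r. f r ` carrier (M r) = lin_ker (I r) (Q r) (g r)"
    and trivial: "carrier (lim1_mod I u) = {\<zero>\<^bsub>lim1_mod I u\<^esub>}"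
  shows "\<exists>\<delta>. \<delta> \<in> lin_epi R (lim_mod Q v) (lim1_mod M t) \<and>
    lin_ker (lim_mod Q v) (lim1_mod M t) \<delta> = prod_map g ` carrier (lim_mod I u) \<and>
    (\<forall>y\<in>carrier (prod_mod I). \<forall>m\<in>carrier (prod_mod M). prod_map f m = shift_diff I u y
      \<longrightarrow> \<delta> (prod_map g y) = (shift_diff M t ` carrier (prod_mod M)) +>\<^bsub>prod_mod M\<^esub> m)"
proof -
  interpret f: int_diagram_hom R M t I u f by fact
  interpret g: int_diagram_hom R I u Q v g by fact
  interpret M: left_module R "M r" for r by (rule f.dom.obj)
  interpret I: left_module R "I r" for r by (rule f.cod.obj)
  interpret Q: left_module R "Q r" for r by (rule g.cod.obj)
  have lim: "lim_mod Q v = (prod_mod Q)\<lparr>carrier := lin_ker (prod_mod Q) (prod_mod Q) (shift_diff Q v)\<rparr>"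
    using g.cod.lim_eq_ker by (simp add: lim_mod_def)
  have f1: "prod_map f \<in> lin_mono R (prod_mod M) (prod_mod I)"
  proof -
    have "inj_on (prod_map f) (carrier (prod_mod M))"
    proof (rule inj_onI, rule ext)
      fix s s' r assume *: "s \<in> carrier (prod_mod M)" "s' \<in> carrier (prod_mod M)" "prod_map f s = prod_map f s'"
      have "s r \<in> carrier (M r)" "s' r \<in> carrier (M r)" using * by (auto simp: prod_mod_def)
      moreover have "f r (s r) = f r (s' r)" using fun_cong[OF *(3), of r] by (simp add: prod_map_def)
      ultimately show "s r = s' r" using inj_onD[OF inj] by blast
    qed
    then show ?thesis using prod_map_hom[of f R M I, OF f.hom] by (simp add: lin_mono_def)
  qed
  have g1: "prod_map g \<in> lin_epi R (prod_mod I) (prod_mod Q)"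
  proof -
    have "s \<in> prod_map g ` carrier (prod_mod I)" if "s \<in> carrier (prod_mod Q)" for s
    proof -
      have "s r \<in> g r ` carrier (I r)" for r using that surj by (simp add: prod_mod_def)
      then have "\<forall>r. \<exists>y. y \<in> carrier (I r) \<and> g r y = s r" by (metis imageE)
      then obtain y where "\<And>r. y r \<in> carrier (I r) \<and> g r (y r) = s r" by metis
      then show ?thesis by (intro image_eqI[of _ _ y]) (auto simp: prod_map_def prod_mod_def)
    qed
    then show ?thesis using prod_map_hom[OF g.hom] lin_hom_closed[OF prod_map_hom[OF g.hom]]
      by (auto simp: lin_epi_def)
  qed
  have fg: "prod_map f ` carrier (prod_mod M) = lin_ker (prod_mod I) (prod_mod Q) (prod_map g)"
  proof
    show "prod_map f ` carrier (prod_mod M) \<subseteq> lin_ker (prod_mod I) (prod_mod Q) (prod_map g)"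
    proof
      fix s assume "s \<in> prod_map f ` carrier (prod_mod M)"
      then obtain x where x: "\<And>r. x r \<in> carrier (M r)" "s = prod_map f x" by (auto simp: prod_mod_def)
      have "s r \<in> lin_ker (I r) (Q r) (g r)" for r
        using x(1)[of r] unfolding exact[symmetric] x(2) prod_map_def by blast
      then show "s \<in> lin_ker (prod_mod I) (prod_mod Q) (prod_map g)"
        by (simp add: lin_ker_def prod_map_def prod_mod_def)
    qed
    show "lin_ker (prod_mod I) (prod_mod Q) (prod_map g) \<subseteq> prod_map f ` carrier (prod_mod M)"
    proof
      fix s assume "s \<in> lin_ker (prod_mod I) (prod_mod Q) (prod_map g)"
      then have "\<forall>r. s r \<in> lin_ker (I r) (Q r) (g r)"
        by (auto simp: lin_ker_def prod_map_def prod_mod_def fun_eq_iff)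
      then have "\<forall>r. \<exists>y. y \<in> carrier (M r) \<and> f r y = s r"
        unfolding exact[symmetric] by (metis imageE)
      then obtain y where "\<And>r. y r \<in> carrier (M r) \<and> f r (y r) = s r" by metis
      then show "s \<in> prod_map f ` carrier (prod_mod M)"
        by (intro image_eqI[of _ _ y]) (auto simp: prod_map_def prod_mod_def)
    qed
  qed
  have nf: "prod_map f (shift_diff M t s) = shift_diff I u (prod_map f s)" if s: "s \<in> carrier (prod_mod M)" for s
  proof
    fix r
    have "s r \<in> carrier (M r)" "s (r - 1) \<in> carrier (M (r - 1))" using s by (auto simp: prod_mod_def)
    then show "prod_map f (shift_diff M t s) r = shift_diff I u (prod_map f s) r"
      using lin_hom_minus[OF f.dom.obj f.cod.obj f.hom _ f.dom.step_closed[OF s]] f.natural[of "s (r - 1)" "r - 1"]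
      by (simp add: prod_map_def shift_diff_def)
  qed
  have ng: "prod_map g (shift_diff I u s) = shift_diff Q v (prod_map g s)" if s: "s \<in> carrier (prod_mod I)" for s
  proof
    fix r
    have "s r \<in> carrier (I r)" "s (r - 1) \<in> carrier (I (r - 1))" using s by (auto simp: prod_mod_def)
    then show "prod_map g (shift_diff I u s) r = shift_diff Q v (prod_map g s) r"
      using lin_hom_minus[OF f.cod.obj g.cod.obj g.hom _ f.cod.step_closed[OF s]] g.natural[of "s (r - 1)" "r - 1"]
      by (simp add: prod_map_def shift_diff_def)
  qed
  have A: "left_module R (prod_mod M)" by (rule left_module_prod) (rule f.dom.obj)
  have B: "left_module R (prod_mod I)" by (rule left_module_prod) (rule f.cod.obj)
  have C: "left_module R (prod_mod Q)" by (rule left_module_prod) (rule g.cod.obj)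
  note dA = f.dom.shift_diff_hom and dB = f.cod.shift_diff_hom and dC = g.cod.shift_diff_hom
  have sur: "shift_diff I u ` carrier (prod_mod I) = carrier (prod_mod I)"
    using trivial unfolding f.cod.lim1_trivial_iff .
  show ?thesis
    unfolding lim lim1_mod_def f.cod.lim_eq_ker 
    by (rule snake[where f = "prod_map f" and g = "prod_map g" and dA = "shift_diff M t"
        and dB = "shift_diff I u" and dC = "shift_diff Q v", OF A B C f1 g1 fg dA dB dC nf ng sur])
qed

text \<open>Every diagram \<^verbatim>\<open>I\<close> embeds into the coinduced diagram \<^verbatim>\<open>r \<mapsto> (\<Prod>q\<ge>r. I q)\<close>; this embedding splits
  if \<^verbatim>\<open>I\<close> is an injective object of the category of diagrams.\<close>

definition coind_mod :: "(int \<Rightarrow> ('r, 'm) module) \<Rightarrow> int \<Rightarrow> ('r, int \<Rightarrow> 'm) module" where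
  "coind_mod I r = (prod_mod I)\<lparr>carrier := {s \<in> carrier (prod_mod I). \<forall>q<r. s q = \<zero>\<^bsub>I q\<^esub>}\<rparr>"

definition coind_map :: "(int \<Rightarrow> ('r, 'm) module) \<Rightarrow> int \<Rightarrow> (int \<Rightarrow> 'm) \<Rightarrow> (int \<Rightarrow> 'm)" where
  "coind_map I r s = s(r := \<zero>\<^bsub>I r\<^esub>)"

definition coind_embed :: "(int \<Rightarrow> ('r, 'm) module) \<Rightarrow> (int \<Rightarrow> 'm \<Rightarrow> 'm) \<Rightarrow> int \<Rightarrow> 'm \<Rightarrow> (int \<Rightarrow> 'm)" where
  "coind_embed I u r x = (\<lambda>q. if r \<le> q then steps u r (nat (q - r)) x else \<zero>\<^bsub>I q\<^esub>)"

context int_diagram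
begin

lemma coind_diagram: "int_diagram R (coind_mod M) (coind_map M)"
proof (rule int_diagram.intro)
  fix r
  interpret M: left_module R "M q" for q by (rule obj)
  have R: "ring R" using obj left_module_def by blast
  have "abelian_group (coind_mod M r)"
  proof (rule abelian_groupI)
    fix s assume s: "s \<in> carrier (coind_mod M r)"
    show "\<exists>y\<in>carrier (coind_mod M r). y \<oplus>\<^bsub>coind_mod M r\<^esub> s = \<zero>\<^bsub>coind_mod M r\<^esub>"
      using s by (intro bexI[of _ "\<lambda>q. \<ominus>\<^bsub>M q\<^esub> s q"])
        (auto simp: coind_mod_def prod_mod_def M.M.l_neg)
  qed (auto simp: coind_mod_def prod_mod_def M.M.a_ac fun_eq_iff)
  then show "left_module R (coind_mod M r)"
    by (intro left_module.intro R left_module_axioms.intro)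
      (auto simp: coind_mod_def prod_mod_def fun_eq_iff M.smult_l_distr M.smult_r_distr
        M.smult_assoc1 M.smult_zero)
  show "coind_map M r \<in> lin_hom R (coind_mod M r) (coind_mod M (r + 1))"
    by (auto simp: lin_hom_def coind_map_def coind_mod_def prod_mod_def fun_eq_iff M.smult_zero)
qed

lemma coind_embed_hom: "int_diagram_hom R M t (coind_mod M) (coind_map M) (coind_embed M t)"
proof -
  interpret M: left_module R "M q" for q by (rule obj)
  interpret C: int_diagram R "coind_mod M" "coind_map M" by (rule coind_diagram)
  have st: "steps t r (nat (q - r)) \<in> lin_hom R (M r) (M q)" if "r \<le> q" for r q
    using steps_hom[of r "nat (q - r)"] that by simp
  show ?thesis
  proof
    fix r
    show "coind_embed M t r \<in> lin_hom R (M r) (coind_mod M r)"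
      using lin_hom_closed[OF st] lin_hom_add[OF st] lin_hom_smult[OF st]
      by (auto simp: lin_hom_def coind_embed_def coind_mod_def prod_mod_def fun_eq_iff M.smult_zero)
  next
    fix x r assume x: "x \<in> carrier (M r)"
    show "coind_embed M t (r + 1) (t r x) = coind_map M r (coind_embed M t r x)"
    proof
      fix q
      have "steps t (r + 1) (nat (q - (r + 1))) (t r x) = steps t r (nat (q - r)) x" if "r < q"
      proof -
        have "nat (q - r) = Suc (nat (q - (r + 1)))" using that by simp
        then show ?thesis using steps_shift by metis
      qed
      then show "coind_embed M t (r + 1) (t r x) q = coind_map M r (coind_embed M t r x) q"
        by (auto simp: coind_embed_def coind_map_def)
    qed
  qed
qed

lemma coind_embed_inj: "inj_on (coind_embed M t r) (carrier (M r))"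
  by (rule inj_onI) (auto simp: coind_embed_def dest!: fun_cong[of _ _ r])

lemma coind_shift_surj:
  "shift_diff (coind_mod M) (coind_map M) ` carrier (prod_mod (coind_mod M)) = carrier (prod_mod (coind_mod M))"
  (is "?S = ?P")
proof
  interpret M: left_module R "M q" for q by (rule obj)
  interpret C: int_diagram R "coind_mod M" "coind_map M" by (rule coind_diagram)
  interpret CM: left_module R "coind_mod M r" for r by (rule C.obj)
  show "?S \<subseteq> ?P" using lin_hom_closed[OF C.shift_diff_hom] by auto
  show "?P \<subseteq> ?S"
  proof
    fix y assume y: "y \<in> ?P"
    have yc: "y r q \<in> carrier (M q)" for r q using y by (auto simp: prod_mod_def coind_mod_def)
    have y0: "y r q = \<zero>\<^bsub>M q\<^esub>" if "q < r" for r q using y that by (auto simp: prod_mod_def coind_mod_def)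
    define x where "x r q = (if r \<le> q then \<ominus>\<^bsub>M q\<^esub> (\<Oplus>\<^bsub>M q\<^esub>p\<in>{r<..q}. y p q) else \<zero>\<^bsub>M q\<^esub>)" for r q
    have xc: "x r q \<in> carrier (M q)" for r q using yc by (auto simp: x_def intro!: M.M.finsum_closed)
    have x: "x \<in> ?P" using xc by (auto simp: prod_mod_def coind_mod_def x_def)
    have cm: "coind_map M (r - 1) (x (r - 1)) \<in> carrier (coind_mod M r)" for r
      using C.step_closed[OF x] .
    have eq: "x r q \<oplus>\<^bsub>M q\<^esub> \<ominus>\<^bsub>M q\<^esub> x (r - 1) q = y r q" if "r \<le> q" for r q
    proof -
      let ?S = "\<Oplus>\<^bsub>M q\<^esub>p\<in>{r<..q}. y p q"
      have "{r - 1<..q} = insert r {r<..q}" using that by auto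
      then have "(\<Oplus>\<^bsub>M q\<^esub>p\<in>{r - 1<..q}. y p q) = y r q \<oplus>\<^bsub>M q\<^esub> ?S"
        using yc M.M.finsum_insert[of "{r<..q}" r "\<lambda>p. y p q" q] by simp
      moreover have "?S \<in> carrier (M q)" using yc by (auto intro!: M.M.finsum_closed)
      ultimately show ?thesis using that yc[of r q]
        by (simp add: x_def M.M.minus_minus M.M.a_ac M.M.r_neg2 M.M.r_neg1 M.M.l_neg M.M.r_neg)
    qed
    have "shift_diff (coind_mod M) (coind_map M) x = y"
    proof
      fix r
      have xr: "x r \<in> carrier (coind_mod M r)" and yr: "y r \<in> carrier (coind_mod M r)"
        using x y by (auto simp: prod_mod_def)
      have "x r = y r \<oplus>\<^bsub>coind_mod M r\<^esub> coind_map M (r - 1) (x (r - 1))"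
      proof
        fix q
        show "x r q = (y r \<oplus>\<^bsub>coind_mod M r\<^esub> coind_map M (r - 1) (x (r - 1))) q"
        proof (cases "r \<le> q")
          case True
          have "x r q = y r q \<oplus>\<^bsub>M q\<^esub> x (r - 1) q"
            using eq[OF True] xc[of r q] xc[of "r - 1" q] by (metis M.M.a_assoc M.M.a_inv_closed M.M.l_neg M.M.r_zero)
          then show ?thesis using True by (simp add: coind_mod_def prod_mod_def coind_map_def)
        next
          case False
          then show ?thesis using y0[of q r] by (auto simp: coind_mod_def prod_mod_def coind_map_def x_def)
        qed
      qed
      then show "shift_diff (coind_mod M) (coind_map M) x r = y r"
        using xr yr cm[of r] by (simp add: shift_diff_def CM.M.minus_eq CM.M.a_assoc CM.M.r_neg)
    qed
    then show "y \<in> ?S" using x by blast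
  qed
qed

end

theorem lim1_injective:
  fixes I :: "int \<Rightarrow> ('r, 'm) module" and R :: "('r, 'z) ring_scheme"
  assumes I: "int_diagram R I u"
    and injective: "\<And>(N :: int \<Rightarrow> ('r, int \<Rightarrow> 'm) module) w e.
      int_diagram_hom R I u N w e \<Longrightarrow> (\<And>r. inj_on (e r) (carrier (I r)))
      \<Longrightarrow> \<exists>p. int_diagram_hom R N w I u p \<and> (\<forall>r. \<forall>x\<in>carrier (I r). p r (e r x) = x)"
  shows "carrier (lim1_mod I u) = {\<zero>\<^bsub>lim1_mod I u\<^esub>}"
proof -
  interpret I: int_diagram R I u by fact
  let ?N = "coind_mod I" and ?w = "coind_map I" and ?e = "coind_embed I u"
  obtain p where p: "int_diagram_hom R ?N ?w I u p"
    and split: "\<And>r x. x \<in> carrier (I r) \<Longrightarrow> p r (?e r x) = x"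
    using injective[OF I.coind_embed_hom I.coind_embed_inj] by blast
  interpret e: int_diagram_hom R I u ?N ?w ?e by (rule I.coind_embed_hom)
  interpret p: int_diagram_hom R ?N ?w I u p by (rule p)
  have "y \<in> shift_diff I u ` carrier (prod_mod I)" if y: "y \<in> carrier (prod_mod I)" for y
  proof -
    have "prod_map ?e y \<in> carrier (prod_mod ?N)"
      by (rule lin_hom_closed[OF prod_map_hom[OF e.hom] y])
    then obtain x where x: "x \<in> carrier (prod_mod ?N)" "shift_diff ?N ?w x = prod_map ?e y"
      using I.coind_shift_surj by (metis imageE)
    have px: "prod_map p x \<in> carrier (prod_mod I)" by (rule lin_hom_closed[OF prod_map_hom[OF p.hom] x(1)])
    have "shift_diff I u (prod_map p x) = y"
    proof
      fix r
      have xr: "x r \<in> carrier (?N r)" "x (r - 1) \<in> carrier (?N (r - 1))" "y r \<in> carrier (I r)"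
        using x(1) y by (auto simp: prod_mod_def)
      have "shift_diff I u (prod_map p x) r = p r (shift_diff ?N ?w x r)"
        using lin_hom_minus[OF e.cod.obj I.obj p.hom xr(1) e.cod.step_closed[OF x(1)]] p.natural[OF xr(2)]
        by (simp add: prod_map_def shift_diff_def)
      also have "\<dots> = y r" using split[OF xr(3)] by (simp add: x(2) prod_map_def)
      finally show "shift_diff I u (prod_map p x) r = y r" .
    qed
    then show ?thesis using px by blast
  qed
  then show ?thesis
    using lin_hom_closed[OF I.shift_diff_hom] unfolding I.lim1_trivial_iff by blast
qed


section \<open>Bigraded exact couples\<close>

type_synonym bideg = "int \<times> int"

definition bidet :: "bideg \<Rightarrow> bideg \<Rightarrow> int" where
  "bidet x y = fst x * snd y - fst y * snd x"

definition biscale :: "int \<Rightarrow> bideg \<Rightarrow> bideg" where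
  "biscale r x = (r * fst x, r * snd x)"

record ('r, 'd, 'e) couple =
  deg_a :: bideg
  deg_b :: bideg
  deg_c :: bideg
  D_mod :: "bideg \<Rightarrow> ('r, 'd) module"
  E_mod :: "bideg \<Rightarrow> ('r, 'e) module"
  i_map :: "bideg \<Rightarrow> 'd \<Rightarrow> 'd"
  j_map :: "bideg \<Rightarrow> 'd \<Rightarrow> 'e"
  k_map :: "bideg \<Rightarrow> 'e \<Rightarrow> 'd"

locale exact_couple = ring R
  for R :: "('r, 'z) ring_scheme" (structure) and C :: "('r, 'd, 'e) couple" +
  assumes D_module: "left_module R (D_mod C x)"
    and E_module: "left_module R (E_mod C x)"
    and i_hom: "i_map C x \<in> lin_hom R (D_mod C x) (D_mod C (x + deg_a C))"
    and j_hom: "j_map C x \<in> lin_hom R (D_mod C x) (E_mod C (x + deg_b C))"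
    and k_hom: "k_map C x \<in> lin_hom R (E_mod C x) (D_mod C (x + deg_c C))"
    and exact_ij:
      "i_map C (x - deg_a C) ` carrier (D_mod C (x - deg_a C))
        = lin_ker (D_mod C x) (E_mod C (x + deg_b C)) (j_map C x)"
    and exact_jk:
      "j_map C x ` carrier (D_mod C x)
        = lin_ker (E_mod C (x + deg_b C)) (D_mod C (x + deg_b C + deg_c C)) (k_map C (x + deg_b C))"
    and exact_ki:
      "k_map C (x + deg_b C) ` carrier (E_mod C (x + deg_b C))
        = lin_ker (D_mod C (x + deg_b C + deg_c C)) (D_mod C (x + deg_a C + deg_b C + deg_c C))
            (i_map C (x + deg_b C + deg_c C))"

definition sigma :: "('r, 'd, 'e) couple \<Rightarrow> int" where
  "sigma C = bidet (deg_a C) (deg_b C + deg_c C)"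

locale regular_exact_couple = exact_couple +
  assumes regular: "sigma C \<in> {1, - 1}"

locale couple_morphism = dom: exact_couple R C + cod: exact_couple R C'
  for R :: "('r, 'z) ring_scheme" (structure)
    and C :: "('r, 'd, 'e) couple" and C' :: "('r, 'd', 'e') couple" +
  fixes fD :: "bideg \<Rightarrow> 'd \<Rightarrow> 'd'" and fE :: "bideg \<Rightarrow> 'e \<Rightarrow> 'e'"
  assumes deg_eq: "deg_a C = deg_a C'" "deg_b C = deg_b C'" "deg_c C = deg_c C'"
    and fD_hom: "fD x \<in> lin_hom R (D_mod C x) (D_mod C' x)"
    and fE_hom: "fE x \<in> lin_hom R (E_mod C x) (E_mod C' x)"
    and comm_i: "d \<in> carrier (D_mod C x) \<Longrightarrow> fD (x + deg_a C) (i_map C x d) = i_map C' x (fD x d)"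
    and comm_j: "d \<in> carrier (D_mod C x) \<Longrightarrow> fE (x + deg_b C) (j_map C x d) = j_map C' x (fD x d)"
    and comm_k: "e \<in> carrier (E_mod C x) \<Longrightarrow> fD (x + deg_c C) (k_map C x e) = k_map C' x (fE x e)"

subsection \<open>The colimit abutment and its filtration\<close>

text \<open>\<^verbatim>\<open>diag_pt C n r\<close> is the point \<^verbatim>\<open>x(n) + r a\<close>, where \<^verbatim>\<open>x(n) = sigma n (b + c)\<close>.\<close>

definition diag_pt :: "('r, 'd, 'e) couple \<Rightarrow> int \<Rightarrow> int \<Rightarrow> bideg" where
  "diag_pt C n r = biscale (sigma C * n) (deg_b C + deg_c C) + biscale r (deg_a C)"

lemma (in regular_exact_couple) bidet_eq_iff:
  "bidet (deg_a C) x = n \<longleftrightarrow> (\<exists>r. x = diag_pt C n r)"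
proof -
  obtain a1 a2 where a: "deg_a C = (a1, a2)" by fastforce
  obtain b1 b2 where b: "deg_b C + deg_c C = (b1, b2)" by fastforce
  obtain x1 x2 where x: "x = (x1, x2)" by fastforce
  define s where "s = sigma C"
  have s: "s = a1 * b2 - b1 * a2" by (simp add: s_def sigma_def bidet_def a b)
  have ss: "s * s = 1" using regular by (auto simp: s_def)
  show ?thesis
  proof
    assume n: "bidet (deg_a C) x = n"
    have 1: "n = a1 * x2 - x1 * a2" using n by (simp add: bidet_def a x mult.commute)
    define m where "m = x1 * b2 - b1 * x2"
    have "n * b1 + m * a1 = s * x1" "n * b2 + m * a2 = s * x2"
      unfolding 1 s m_def by (simp_all add: algebra_simps)
    then have "s * n * b1 + s * m * a1 = s * s * x1" "s * n * b2 + s * m * a2 = s * s * x2"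
      by (metis distrib_left mult.assoc)+
    then have "x = diag_pt C n (s * m)"
      by (simp add: ss diag_pt_def biscale_def a b x s_def[symmetric])
    then show "\<exists>r. x = diag_pt C n r" ..
  next
    assume "\<exists>r. x = diag_pt C n r"
    then obtain r where r: "x1 = s * n * b1 + r * a1" "x2 = s * n * b2 + r * a2"
      by (auto simp: diag_pt_def biscale_def a b x s_def)
    have "a1 * x2 - x1 * a2 = n * (s * (a1 * b2 - b1 * a2))"
      unfolding r by (simp add: algebra_simps)
    also have "\<dots> = n" by (simp add: ss flip: s)
    finally show "bidet (deg_a C) x = n"
      by (simp add: bidet_def a x mult.commute)
  qed
qed

abbreviation D_diag :: "('r, 'd, 'e) couple \<Rightarrow> int \<Rightarrow> int \<Rightarrow> ('r, 'd) module" where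
  "D_diag C n \<equiv> (\<lambda>r. D_mod C (diag_pt C n r))"

abbreviation i_diag :: "('r, 'd, 'e) couple \<Rightarrow> int \<Rightarrow> int \<Rightarrow> 'd \<Rightarrow> 'd" where
  "i_diag C n \<equiv> (\<lambda>r. i_map C (diag_pt C n r))"

lemma diag_pt_step: "diag_pt C n r + deg_a C = diag_pt C n (r + 1)"
  by (simp add: diag_pt_def biscale_def prod_eq_iff algebra_simps)

lemma (in exact_couple) diag_int_diagram: "int_diagram R (D_diag C n) (i_diag C n)"
proof (rule int_diagram.intro)
  show "left_module R (D_mod C (diag_pt C n r))" for r by (rule D_module)
  show "i_map C (diag_pt C n r) \<in> lin_hom R (D_mod C (diag_pt C n r)) (D_mod C (diag_pt C n (r + 1)))" for r
    using i_hom[of "diag_pt C n r"] by (simp add: diag_pt_step)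
qed

definition L_mod :: "('r, 'd, 'e) couple \<Rightarrow> int \<Rightarrow> ('r, (int \<times> 'd) set) module" where
  "L_mod C n = colim_mod (D_diag C n) (i_diag C n)"

text \<open>\<^verbatim>\<open>F_mod C x\<close> is a submodule of \<^verbatim>\<open>L_mod C n\<close> for \<^verbatim>\<open>n = bidet (deg_a C) x\<close>; the index \<^verbatim>\<open>r\<close> with
  \<^verbatim>\<open>x = diag_pt C n r\<close> is unique when the couple is regular, see \<^verbatim>\<open>diag_pt_inj\<close>.\<close>

definition F_mod :: "('r, 'd, 'e) couple \<Rightarrow> bideg \<Rightarrow> ('r, (int \<times> 'd) set) module" where
  "F_mod C x = (let n = bidet (deg_a C) x in
     (L_mod C n)\<lparr>carrier := {germ (D_diag C n) (i_diag C n) r d |r d.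
        x = diag_pt C n r \<and> d \<in> carrier (D_mod C x)}\<rparr>)"

definition eps_mod :: "('r, 'd, 'e) couple \<Rightarrow> bideg \<Rightarrow> ('r, (int \<times> 'd) set set) module" where
  "eps_mod C x = quot_mod (F_mod C x) (carrier (F_mod C (x - deg_a C)))"

abbreviation F_diag :: "('r, 'd, 'e) couple \<Rightarrow> int \<Rightarrow> int \<Rightarrow> ('r, (int \<times> 'd) set) module" where
  "F_diag C n \<equiv> (\<lambda>r. F_mod C (diag_pt C n r))"

abbreviation incl_diag :: "int \<Rightarrow> 'm \<Rightarrow> 'm" where
  "incl_diag \<equiv> (\<lambda>r y. y)"

lemma (in regular_exact_couple) diag_pt_inj: "diag_pt C n r = diag_pt C n s \<longleftrightarrow> r = s"
proof
  assume "diag_pt C n r = diag_pt C n s"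
  then have "biscale r (deg_a C) = biscale s (deg_a C)" by (simp add: diag_pt_def)
  moreover have "fst (deg_a C) \<noteq> 0 \<or> snd (deg_a C) \<noteq> 0" using regular by (auto simp: sigma_def bidet_def)
  ultimately show "r = s" by (auto simp: biscale_def)
qed simp

lemma (in regular_exact_couple) F_diag_eq:
  "F_diag C n r = (L_mod C n)\<lparr>carrier := germ (D_diag C n) (i_diag C n) r ` carrier (D_diag C n r)\<rparr>"
proof -
  have "bidet (deg_a C) (diag_pt C n r) = n" using bidet_eq_iff by blast
  then show ?thesis by (simp add: F_mod_def Let_def diag_pt_inj Setcompr_eq_image)
qed

definition limF_mod :: "('r, 'd, 'e) couple \<Rightarrow> int \<Rightarrow> ('r, int \<Rightarrow> (int \<times> 'd) set) module" where
  "limF_mod C n = lim_mod (F_diag C n) incl_diag"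

definition lim1F_mod :: "('r, 'd, 'e) couple \<Rightarrow> int \<Rightarrow> ('r, (int \<Rightarrow> (int \<times> 'd) set) set) module" where
  "lim1F_mod C n = lim1_mod (F_diag C n) incl_diag"

text \<open>The maps induced by a morphism of exact couples into \<^verbatim>\<open>C'\<close> with components \<^verbatim>\<open>fD\<close>.\<close>

definition L_map ::
  "('r, 'd', 'e') couple \<Rightarrow> (bideg \<Rightarrow> 'd \<Rightarrow> 'd') \<Rightarrow> int \<Rightarrow> (int \<times> 'd) set \<Rightarrow> (int \<times> 'd') set" where
  "L_map C' fD n = colim_map (D_diag C' n) (i_diag C' n) (\<lambda>r. fD (diag_pt C' n r))"

definition eps_map ::
  "('r, 'd', 'e') couple \<Rightarrow> (bideg \<Rightarrow> 'd \<Rightarrow> 'd') \<Rightarrow> bideg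
    \<Rightarrow> (int \<times> 'd) set set \<Rightarrow> (int \<times> 'd') set set" where
  "eps_map C' fD x = quot_map (F_mod C' x) (carrier (F_mod C' (x - deg_a C')))
     (L_map C' fD (bidet (deg_a C') x))"

definition limF_map ::
  "('r, 'd', 'e') couple \<Rightarrow> (bideg \<Rightarrow> 'd \<Rightarrow> 'd') \<Rightarrow> int
    \<Rightarrow> (int \<Rightarrow> (int \<times> 'd) set) \<Rightarrow> (int \<Rightarrow> (int \<times> 'd') set)" where
  "limF_map C' fD n = prod_map (\<lambda>r. L_map C' fD n)"

definition lim1F_map ::
  "('r, 'd', 'e') couple \<Rightarrow> (bideg \<Rightarrow> 'd \<Rightarrow> 'd') \<Rightarrow> int
    \<Rightarrow> (int \<Rightarrow> (int \<times> 'd) set) set \<Rightarrow> (int \<Rightarrow> (int \<times> 'd') set) set" where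
  "lim1F_map C' fD n = lim1_map (F_diag C' n) incl_diag (\<lambda>r. L_map C' fD n)"

end

theory Submission
  imports Defs
begin

text \<open>
  The theorem is a comparison result for filtered modules.  Let \<^verbatim>\<open>h\<close> be a filtered linear map from
  \<^verbatim>\<open>L\<close> to \<^verbatim>\<open>L'\<close>, where \<^verbatim>\<open>L\<close> is the union of an increasing family of submodules \<^verbatim>\<open>F r\<close> and \<^verbatim>\<open>L'\<close> of
  \<^verbatim>\<open>F' r\<close>, with \<^verbatim>\<open>r\<close> ranging over the integers.  The usual argument applies the five lemma to the
  exact sequences \<^verbatim>\<open>0 \<rightarrow> lim F \<rightarrow> F r \<rightarrow> lim (F r / F q) \<rightarrow> lim1 F \<rightarrow> 0\<close>; unwinding it on elements
  yields a shorter proof in which no sequence has to be built.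

  Surjectivity (\<^verbatim>\<open>filtered_hom.surjective\<close>).  Start with \<^verbatim>\<open>y\<close> in \<^verbatim>\<open>F' r\<close>.  As the associated graded map
  is onto, subtracting elements \<^verbatim>\<open>h (u q)\<close>, \<^verbatim>\<open>q = r, r - 1, \<dots>\<close>, pushes \<^verbatim>\<open>y\<close> further and further down
  the filtration.  The successive remainders \<^verbatim>\<open>Y q\<close> in \<^verbatim>\<open>F' q\<close> satisfy \<^verbatim>\<open>Y q - Y (q - 1) = h (u q)\<close>,
  so the family \<^verbatim>\<open>u\<close> represents a class of \<^verbatim>\<open>lim1 F\<close> that dies in \<^verbatim>\<open>lim1 F'\<close>
  (\<^verbatim>\<open>filtered_hom.telescope\<close>).  Since \<^verbatim>\<open>lim1\<close> of \<^verbatim>\<open>h\<close> is a monomorphism, \<^verbatim>\<open>u q = x q - x (q - 1)\<close> for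
  some \<^verbatim>\<open>x q\<close> in \<^verbatim>\<open>F q\<close>.  Then \<^verbatim>\<open>Y - h x\<close> has zero differences, hence lies in \<^verbatim>\<open>lim F'\<close> and is the image of
  some \<^verbatim>\<open>v\<close> in \<^verbatim>\<open>lim F\<close>; in degree \<^verbatim>\<open>r\<close> this says \<^verbatim>\<open>y = h (v r + x r)\<close>.

  Injectivity (\<^verbatim>\<open>filtered_hom.injective\<close>).  If \<^verbatim>\<open>h x = 0\<close> and \<^verbatim>\<open>x\<close> lies in \<^verbatim>\<open>F q\<close>, then injectivity of the
  graded map puts \<^verbatim>\<open>x\<close> in \<^verbatim>\<open>F (q - 1)\<close>.  So \<^verbatim>\<open>x\<close> lies in every \<^verbatim>\<open>F q\<close>, that is, in \<^verbatim>\<open>lim F\<close>, on which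
  \<^verbatim>\<open>h\<close> is injective.

  These results apply to the abutment because the colimit of a diagram of modules indexed by the integers is a module
  that is exhausted by the images of the modules of the diagram, and a map of diagrams induces a
  filtered map (\<^verbatim>\<open>int_diagram_hom.colim_filtered_hom\<close>).
\<close>

section \<open>Submodules and quotients\<close>

lemma lin_hom_image_submodule:
  assumes A: "left_module R A" and B: "left_module R B" and h: "h \<in> lin_hom R A B"
  shows "submodule (h ` carrier A) R B"
proof -
  interpret A: left_module R A by fact
  interpret B: left_module R B by fact
  have "subgroup (h ` carrier A) (add_monoid B)"
  proof (rule B.M.add.subgroupI)
    show "h ` carrier A \<subseteq> carrier B" using lin_hom_closed[OF h] by auto
    show "h ` carrier A \<noteq> {}" using A.M.zero_closed by blast
    fix b assume "b \<in> h ` carrier A"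
    then obtain x where x: "x \<in> carrier A" "b = h x" by auto
    have "h (\<zero>\<^bsub>A\<^esub> \<ominus>\<^bsub>A\<^esub> x) = \<ominus>\<^bsub>B\<^esub> b"
      using x lin_hom_closed[OF h x(1)] lin_hom_zero[OF A B h]
      by (simp add: lin_hom_minus[OF A B h] B.M.minus_eq)
    then show "\<ominus>\<^bsub>B\<^esub> b \<in> h ` carrier A"
      using x by (metis A.M.minus_closed A.M.zero_closed imageI)
  next
    fix b b' assume "b \<in> h ` carrier A" "b' \<in> h ` carrier A"
    then show "b \<oplus>\<^bsub>B\<^esub> b' \<in> h ` carrier A"
      using lin_hom_add[OF h] by (metis (no_types, lifting) A.M.add.m_closed image_iff)
  qed
  moreover have "c \<odot>\<^bsub>B\<^esub> b \<in> h ` carrier A" if "c \<in> carrier R" "b \<in> h ` carrier A" for c b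
    using that lin_hom_smult[OF h] by (metis (no_types, lifting) A.smult_closed image_iff)
  ultimately show ?thesis by (simp add: submodule_def submodule_axioms_def)
qed

lemma submodule_left_module:
  assumes M: "left_module R M" and H: "submodule H R M"
  shows "left_module R (M\<lparr>carrier := H\<rparr>)"
proof -
  interpret M: left_module R M by fact
  interpret H: submodule H R M by fact
  have sub: "x \<in> carrier M" if "x \<in> H" for x using H.subset that by auto
  have add: "x \<oplus>\<^bsub>M\<^esub> y \<in> H" if "x \<in> H" "y \<in> H" for x y using H.m_closed that by simp
  have zero: "\<zero>\<^bsub>M\<^esub> \<in> H" using H.one_closed by simp
  have inv: "\<ominus>\<^bsub>M\<^esub> x \<in> H" if "x \<in> H" for x using H.m_inv_closed that by (simp add: a_inv_def)
  have "abelian_group (M\<lparr>carrier := H\<rparr>)"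
  proof (rule abelian_groupI)
    fix x assume x: "x \<in> carrier (M\<lparr>carrier := H\<rparr>)"
    show "\<exists>y\<in>carrier (M\<lparr>carrier := H\<rparr>). y \<oplus>\<^bsub>M\<lparr>carrier := H\<rparr>\<^esub> x = \<zero>\<^bsub>M\<lparr>carrier := H\<rparr>\<^esub>"
      using x sub[of x] inv[of x] by (intro bexI[of _ "\<ominus>\<^bsub>M\<^esub> x"]) (auto simp: M.M.l_neg)
  qed (auto simp: sub add zero M.M.a_ac)
  then show ?thesis
    by (intro left_module.intro M.R.ring_axioms left_module_axioms.intro)
      (auto simp: sub M.smult_l_distr M.smult_r_distr M.smult_assoc1)
qed

text \<open>Inclusions are linear, so facts on linear maps and their images transfer to submodules; the
  two lemmas after this one are obtained in that way.\<close>

lemma submodule_inclusion: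
  assumes "H \<subseteq> K"
  shows "(\<lambda>x. x) \<in> lin_hom R (M\<lparr>carrier := H\<rparr>) (M\<lparr>carrier := K\<rparr>)"
  using assms by (auto simp: lin_hom_def)

lemma submodule_restrict:
  assumes M: "left_module R M" and "submodule H R M" and "submodule K R M" and "H \<subseteq> K"
  shows "submodule H R (M\<lparr>carrier := K\<rparr>)"
  using lin_hom_image_submodule[OF submodule_left_module[OF M assms(2)]
      submodule_left_module[OF M assms(3)] submodule_inclusion[OF assms(4)]] by simp

text \<open>Subtraction in a submodule involves the inverse taken in its own, smaller carrier, so the
  agreement with the ambient subtraction is not a matter of unfolding.\<close>

lemma submodule_minus:
  assumes M: "left_module R M" and H: "submodule H R M" and "x \<in> H" "y \<in> H"
  shows "x \<ominus>\<^bsub>M\<lparr>carrier := H\<rparr>\<^esub> y = x \<ominus>\<^bsub>M\<^esub> y"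
proof -
  have "(\<lambda>x. x) \<in> lin_hom R (M\<lparr>carrier := H\<rparr>) M"
    using subgroup.subset[OF submodule.axioms(1)[OF H]] by (auto simp: lin_hom_def)
  from lin_hom_minus[OF submodule_left_module[OF M H] M this] show ?thesis using assms by simp
qed

text \<open>The next three lemmas turn statements on induced maps of quotients, which are maps of cosets,
  into statements on representatives.  They serve both for the graded pieces and for the cokernel
  that defines \<^verbatim>\<open>lim1_mod\<close>.\<close>

lemma quot_map_coset:
  assumes M: "left_module R M" and M': "left_module R M'" and h: "h \<in> lin_hom R M M'"
    and N: "subgroup N (add_monoid M)" and N': "subgroup N' (add_monoid M')"
    and NN: "h ` N \<subseteq> N'" and x: "x \<in> carrier M"
  shows "quot_map M' N' h (N +>\<^bsub>M\<^esub> x) = N' +>\<^bsub>M'\<^esub> h x"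
proof -
  interpret M: left_module R M by fact
  interpret M': left_module R M' by fact
  have sub: "N \<subseteq> carrier M" using subgroup.subset[OF N] by simp
  have "N' +>\<^bsub>M'\<^esub> h y = N' +>\<^bsub>M'\<^esub> h x" if y: "y \<in> N +>\<^bsub>M\<^esub> x" for y
  proof -
    have yc: "y \<in> carrier M" by (rule subsetD[OF M.M.a_r_coset_subset_G[OF sub x] y])
    have "N +>\<^bsub>M\<^esub> y = N +>\<^bsub>M\<^esub> x" by (rule M.M.a_repr_independence[OF y x N, symmetric])
    then have "y \<ominus>\<^bsub>M\<^esub> x \<in> N" unfolding M.coset_eq_iff[OF N yc x] .
    then have "h y \<ominus>\<^bsub>M'\<^esub> h x \<in> N'" using NN lin_hom_minus[OF M M' h yc x] by force
    then show ?thesis unfolding M'.coset_eq_iff[OF N' lin_hom_closed[OF h yc] lin_hom_closed[OF h x]] .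
  qed
  moreover have "N +>\<^bsub>M\<^esub> x \<noteq> {}" using M.M.add.rcos_self[OF x N, folded a_r_coset_def] by blast
  ultimately show ?thesis unfolding quot_map_def by (intro SUP_eq_const)
qed

lemma quot_carrier: "carrier (quot_mod M N) = {N +>\<^bsub>M\<^esub> x |x. x \<in> carrier M}"
  by (auto simp: quot_mod_def A_RCOSETS_def RCOSETS_def a_r_coset_def)

lemma quot_map_inj_imp:
  assumes M: "left_module R M" and M': "left_module R M'" and h: "h \<in> lin_hom R M M'"
    and N: "subgroup N (add_monoid M)" and N': "subgroup N' (add_monoid M')" and NN: "h ` N \<subseteq> N'"
    and inj: "inj_on (quot_map M' N' h) (carrier (quot_mod M N))"
    and x: "x \<in> carrier M" and hx: "h x \<in> N'"
  shows "x \<in> N"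
proof -
  interpret M: left_module R M by fact
  interpret M': left_module R M' by fact
  have z: "\<zero>\<^bsub>M'\<^esub> \<in> N'" using subgroup.one_closed[OF N'] by simp
  have "quot_map M' N' h (N +>\<^bsub>M\<^esub> x) = N' +>\<^bsub>M'\<^esub> h x"
    by (rule quot_map_coset[OF M M' h N N' NN x])
  also have "\<dots> = N' +>\<^bsub>M'\<^esub> \<zero>\<^bsub>M'\<^esub>"
    using M'.M.a_coset_join2[OF _ N'] hx z lin_hom_closed[OF h x] by simp
  also have "\<dots> = quot_map M' N' h (N +>\<^bsub>M\<^esub> \<zero>\<^bsub>M\<^esub>)"
    by (simp add: quot_map_coset[OF M M' h N N' NN] lin_hom_zero[OF M M' h])
  finally have "N +>\<^bsub>M\<^esub> x = N +>\<^bsub>M\<^esub> \<zero>\<^bsub>M\<^esub>"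
    using inj x M.M.zero_closed unfolding quot_carrier by (blast dest: inj_onD)
  also have "\<dots> = N"
    using subgroup.one_closed[OF N] by (intro M.M.a_coset_join2[OF _ N]) auto
  finally show ?thesis using M.M.add.rcos_self[OF x N, folded a_r_coset_def] by simp
qed

lemma quot_map_surj_imp:
  assumes M: "left_module R M" and M': "left_module R M'" and h: "h \<in> lin_hom R M M'"
    and N: "subgroup N (add_monoid M)" and N': "subgroup N' (add_monoid M')" and NN: "h ` N \<subseteq> N'"
    and surj: "quot_map M' N' h ` carrier (quot_mod M N) = carrier (quot_mod M' N')"
    and y: "y \<in> carrier M'"
  shows "\<exists>x\<in>carrier M. y \<ominus>\<^bsub>M'\<^esub> h x \<in> N'"
proof -
  interpret M': left_module R M' by fact
  have "N' +>\<^bsub>M'\<^esub> y \<in> quot_map M' N' h ` carrier (quot_mod M N)"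
    unfolding surj unfolding quot_carrier using y by blast
  then obtain x where x: "x \<in> carrier M" "quot_map M' N' h (N +>\<^bsub>M\<^esub> x) = N' +>\<^bsub>M'\<^esub> y"
    unfolding quot_carrier by force
  then have "N' +>\<^bsub>M'\<^esub> y = N' +>\<^bsub>M'\<^esub> h x" using quot_map_coset[OF M M' h N N' NN] by simp
  then show ?thesis using x M'.coset_eq_iff[OF N' y lin_hom_closed[OF h x(1)]] by blast
qed

lemma (in int_diagram_hom) prod_map_shift_diff:
  assumes s: "s \<in> carrier (prod_mod M)"
  shows "prod_map f (shift_diff M t s) = shift_diff N u (prod_map f s)"
proof
  fix r
  have "s r \<in> carrier (M r)" "s (r - 1) \<in> carrier (M (r - 1))" using s by (auto simp: prod_mod_def)
  then show "prod_map f (shift_diff M t s) r = shift_diff N u (prod_map f s) r"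
    using lin_hom_minus[OF dom.obj cod.obj hom _ dom.step_closed[OF s]] natural[of "s (r - 1)" "r - 1"]
    by (simp add: prod_map_def shift_diff_def)
qed


section \<open>Comparison of filtered modules\<close>

text \<open>The intersection of the \<^verbatim>\<open>F r\<close>, which is their limit, may be nonzero, and \<^verbatim>\<open>L\<close> may be incomplete;
  the latter defect is what \<^verbatim>\<open>lim1\<close> measures.\<close>

locale filtered_module = left_module R L
  for R :: "('r, 'z) ring_scheme" and L :: "('r, 'm) module" +
  fixes F :: "int \<Rightarrow> 'm set"
  assumes submod: "submodule (F r) R L"
    and step: "F r \<subseteq> F (r + 1)"
    and exhaustive: "carrier L = (\<Union>r. F r)"
begin

abbreviation piece :: "int \<Rightarrow> ('r, 'm) module" where
  "piece r \<equiv> L\<lparr>carrier := F r\<rparr>"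

lemma mono: "r \<le> s \<Longrightarrow> F r \<subseteq> F s"
  by (induction s rule: int_ge_induct) (use step in auto)

lemma sub: "x \<in> F r \<Longrightarrow> x \<in> carrier L"
  using exhaustive by auto

lemma piece_module: "left_module R (piece r)"
  by (rule submodule_left_module[OF left_module_axioms submod])

lemma piece_minus: "x \<in> F r \<Longrightarrow> y \<in> F r \<Longrightarrow> x \<ominus>\<^bsub>piece r\<^esub> y = x \<ominus>\<^bsub>L\<^esub> y"
  by (rule submodule_minus[OF left_module_axioms submod])

lemma piece_subgroup: "subgroup (F (r - 1)) (add_monoid (piece r))"
  by (rule submodule.axioms(1)[OF submodule_restrict[OF left_module_axioms submod submod]])
    (use mono in simp)

lemma diagram: "int_diagram R piece incl_diag"
  by (intro int_diagram.intro piece_module submodule_inclusion step)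

lemma shift_diff_piece:
  assumes "s \<in> carrier (prod_mod piece)"
  shows "shift_diff piece incl_diag s = (\<lambda>r. s r \<ominus>\<^bsub>L\<^esub> s (r - 1))"
  using assms step[of "r - 1" for r] unfolding shift_diff_def
  by (intro ext piece_minus) (auto simp: prod_mod_def)

text \<open>The limit is the kernel of the linear map \<^verbatim>\<open>shift_diff\<close>.\<close>

lemma shift_diff_eq_imp:
  assumes s: "s \<in> carrier (prod_mod piece)" and s': "s' \<in> carrier (prod_mod piece)"
    and eq: "shift_diff piece incl_diag s = shift_diff piece incl_diag s'"
  shows "(\<lambda>r. s r \<ominus>\<^bsub>L\<^esub> s' r) \<in> carrier (lim_mod piece incl_diag)"
proof -
  interpret D: int_diagram R piece incl_diag by (rule diagram)
  interpret P: left_module R "prod_mod piece" by (rule left_module_prod[OF piece_module])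
  have P: "left_module R (prod_mod piece)" by (rule P.left_module_axioms)
  have "shift_diff piece incl_diag (s \<ominus>\<^bsub>prod_mod piece\<^esub> s') = \<zero>\<^bsub>prod_mod piece\<^esub>"
    using lin_hom_minus[OF P P D.shift_diff_hom s s'] eq
      lin_hom_closed[OF D.shift_diff_hom s'] by (simp add: P.minus_zero_iff)
  then have "s \<ominus>\<^bsub>prod_mod piece\<^esub> s' \<in> carrier (lim_mod piece incl_diag)"
    using s s' unfolding D.lim_eq_ker lin_ker_def by simp
  moreover have "s \<ominus>\<^bsub>prod_mod piece\<^esub> s' = (\<lambda>r. s r \<ominus>\<^bsub>L\<^esub> s' r)"
  proof
    fix r
    have "(\<lambda>s. s r) \<in> lin_hom R (prod_mod piece) (piece r)" by (auto simp: lin_hom_def prod_mod_def)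
    from lin_hom_minus[OF P piece_module this s s']
    show "(s \<ominus>\<^bsub>prod_mod piece\<^esub> s') r = s r \<ominus>\<^bsub>L\<^esub> s' r"
      using s s' by (simp add: piece_minus prod_mod_def)
  qed
  ultimately show ?thesis by simp
qed

end

locale filtered_hom = dom: filtered_module R L F + cod: filtered_module R L' F'
  for R :: "('r, 'z) ring_scheme" and L :: "('r, 'm) module" and F
    and L' :: "('r, 'n) module" and F' +
  fixes h :: "'m \<Rightarrow> 'n"
  assumes h: "h \<in> lin_hom R L L'"
    and filtered: "h ` F r \<subseteq> F' r"
begin

lemma piece_hom: "h \<in> lin_hom R (dom.piece r) (cod.piece r)"
  using h filtered[of r] dom.sub by (auto simp: lin_hom_def)

lemma diagram_hom: "int_diagram_hom R dom.piece incl_diag cod.piece incl_diag (\<lambda>r. h)"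
  by (intro int_diagram_hom.intro int_diagram_hom_axioms.intro dom.diagram cod.diagram piece_hom) simp

abbreviation gr_map :: "int \<Rightarrow> 'm set \<Rightarrow> 'n set" where
  "gr_map r \<equiv> quot_map (cod.piece r) (F' (r - 1)) h"

abbreviation gr_dom :: "int \<Rightarrow> ('r, 'm set) module" where
  "gr_dom r \<equiv> quot_mod (dom.piece r) (F (r - 1))"

abbreviation gr_cod :: "int \<Rightarrow> ('r, 'n set) module" where
  "gr_cod r \<equiv> quot_mod (cod.piece r) (F' (r - 1))"

lemmas gr_facts = dom.piece_module cod.piece_module piece_hom dom.piece_subgroup cod.piece_subgroup filtered

text \<open>Successive approximation of \<^verbatim>\<open>y\<close> by images.  There need be no limit of the approximations in
  \<^verbatim>\<open>L\<close>; the conclusion records only the family \<^verbatim>\<open>u\<close> of corrections, whose class in \<^verbatim>\<open>lim1\<close> of the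
  source is the obstruction to summing them, and which becomes trivial in the target by way of \<^verbatim>\<open>Y\<close>.\<close>

lemma telescope:
  assumes gr: "\<And>r. gr_map r ` carrier (gr_dom r) = carrier (gr_cod r)" and y: "y \<in> F' r"
  obtains u Y where "u \<in> carrier (prod_mod dom.piece)" "Y \<in> carrier (prod_mod cod.piece)" "Y r = y"
    "shift_diff cod.piece incl_diag Y = prod_map (\<lambda>r. h) u"
proof -
  have "\<exists>x\<in>F q. y \<ominus>\<^bsub>L'\<^esub> h x \<in> F' (q - 1)" if y: "y \<in> F' q" for q y
  proof -
    obtain x where x: "x \<in> F q" "y \<ominus>\<^bsub>cod.piece q\<^esub> h x \<in> F' (q - 1)"
      using quot_map_surj_imp[OF gr_facts gr, of y q] y by auto
    moreover have "h x \<in> F' q" using x(1) filtered by auto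
    ultimately show ?thesis using cod.piece_minus[OF y] by auto
  qed
  then have "\<exists>U. \<forall>q y. y \<in> F' q \<longrightarrow> U q y \<in> F q \<and> y \<ominus>\<^bsub>L'\<^esub> h (U q y) \<in> F' (q - 1)"
    by (intro choice allI) blast
  then obtain U where U: "\<And>q y. y \<in> F' q \<Longrightarrow> U q y \<in> F q"
      "\<And>q y. y \<in> F' q \<Longrightarrow> y \<ominus>\<^bsub>L'\<^esub> h (U q y) \<in> F' (q - 1)"
    by blast
  define z where "z = rec_nat y (\<lambda>k v. v \<ominus>\<^bsub>L'\<^esub> h (U (r - int k) v))"
  have z0: "z 0 = y" and zS: "z (Suc k) = z k \<ominus>\<^bsub>L'\<^esub> h (U (r - int k) (z k))" for k
    by (simp_all add: z_def)
  have zF: "z k \<in> F' (r - int k)" for k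
  proof (induction k)
    case (Suc k)
    then show ?case using U(2)[OF Suc] by (simp add: zS algebra_simps)
  qed (simp add: z0 y)
  \<comment> \<open>For \<^verbatim>\<open>q \<ge> r\<close> the truncation in \<^verbatim>\<open>nat\<close> makes \<^verbatim>\<open>Y\<close> constant with value \<^verbatim>\<open>y\<close>, which is allowed
    because the filtration increases; the matching corrections are zero.\<close>
  define Y where "Y q = z (nat (r - q))" for q
  define u where "u q = (if q \<le> r then U q (Y q) else \<zero>\<^bsub>L\<^esub>)" for q
  have YF: "Y q \<in> F' q" for q
    using zF[of "nat (r - q)"] cod.mono[of r q] by (cases "q \<le> r") (auto simp: Y_def)
  have uF: "u q \<in> F q" for q
    using U(1)[OF YF] subgroup.one_closed[OF submodule.axioms(1)[OF dom.submod, of q]] by (auto simp: u_def)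
  have uP: "u \<in> carrier (prod_mod dom.piece)" and YP: "Y \<in> carrier (prod_mod cod.piece)"
    using uF YF by (auto simp: prod_mod_def)
  have "Y q \<ominus>\<^bsub>L'\<^esub> Y (q - 1) = h (u q)" for q
  proof (cases "q \<le> r")
    case True
    have "nat (r - (q - 1)) = Suc (nat (r - q))" using True by simp
    then have "Y (q - 1) = Y q \<ominus>\<^bsub>L'\<^esub> h (u q)" using True zS[of "nat (r - q)"] by (simp add: Y_def u_def)
    moreover have "Y q \<in> carrier L'" "h (u q) \<in> carrier L'"
      using cod.sub[OF YF] lin_hom_closed[OF h dom.sub[OF uF]] by auto
    ultimately show ?thesis
      by (simp add: cod.M.minus_eq cod.M.minus_add cod.M.minus_minus cod.M.r_neg2)
  next
    case False
    then have "Y q = Y (q - 1)" by (simp add: Y_def)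
    then show ?thesis
      using False cod.sub[OF YF] lin_hom_zero[OF dom.left_module_axioms cod.left_module_axioms h]
      by (simp add: u_def cod.minus_zero_iff)
  qed
  then have "shift_diff cod.piece incl_diag Y = prod_map (\<lambda>r. h) u"
    by (simp add: cod.shift_diff_piece[OF YP] prod_map_def)
  then show ?thesis using that[OF uP YP] by (simp add: Y_def z0)
qed

text \<open>The corrections produced by \<^verbatim>\<open>telescope\<close> die in \<^verbatim>\<open>lim1\<close> of the target, hence in \<^verbatim>\<open>lim1\<close> of the
  source, where they can therefore be summed to a family \<^verbatim>\<open>x\<close>.  The error \<^verbatim>\<open>Y - h x\<close> is an element of
  the limit, which surjectivity on limits removes.\<close>

theorem surjective:
  assumes gr: "\<And>r. gr_map r ` carrier (gr_dom r) = carrier (gr_cod r)"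
    and lim: "prod_map (\<lambda>r. h) ` carrier (lim_mod dom.piece incl_diag) = carrier (lim_mod cod.piece incl_diag)"
    and lim1: "inj_on (lim1_map cod.piece incl_diag (\<lambda>r. h)) (carrier (lim1_mod dom.piece incl_diag))"
  shows "h ` carrier L = carrier L'"
proof
  show "h ` carrier L \<subseteq> carrier L'" using lin_hom_closed[OF h] by auto
  interpret D: int_diagram_hom R dom.piece incl_diag cod.piece incl_diag "\<lambda>r. h" by (rule diagram_hom)
  have PD: "left_module R (prod_mod dom.piece)" and PC: "left_module R (prod_mod cod.piece)"
    by (rule left_module_prod, rule dom.piece_module cod.piece_module)+
  have ph: "prod_map (\<lambda>r. h) \<in> lin_hom R (prod_mod dom.piece) (prod_mod cod.piece)"
    by (rule prod_map_hom[OF piece_hom])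
  show "carrier L' \<subseteq> h ` carrier L"
  proof
    fix y assume "y \<in> carrier L'"
    then obtain r where "y \<in> F' r" using cod.exhaustive by auto
    then obtain u Y where u: "u \<in> carrier (prod_mod dom.piece)" and Y: "Y \<in> carrier (prod_mod cod.piece)"
      "Y r = y" and uY: "shift_diff cod.piece incl_diag Y = prod_map (\<lambda>r. h) u"
      using telescope[OF gr] by blast
    have "u \<in> shift_diff dom.piece incl_diag ` carrier (prod_mod dom.piece)"
    proof (rule quot_map_inj_imp[OF PD PC ph D.dom.shift_diff_range_subgroup D.cod.shift_diff_range_subgroup
          _ _ u])
      show "prod_map (\<lambda>r. h) ` shift_diff dom.piece incl_diag ` carrier (prod_mod dom.piece)
        \<subseteq> shift_diff cod.piece incl_diag ` carrier (prod_mod cod.piece)"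
        using D.prod_map_shift_diff lin_hom_closed[OF ph] by auto
      show "prod_map (\<lambda>r. h) u \<in> shift_diff cod.piece incl_diag ` carrier (prod_mod cod.piece)"
        using Y(1) unfolding uY[symmetric] by blast
    qed (use lim1 in \<open>simp add: lim1_map_def lim1_mod_def\<close>)
    then obtain x where x: "x \<in> carrier (prod_mod dom.piece)" "u = shift_diff dom.piece incl_diag x" by auto
    have hx: "prod_map (\<lambda>r. h) x \<in> carrier (prod_mod cod.piece)" by (rule lin_hom_closed[OF ph x(1)])
    have "(\<lambda>q. Y q \<ominus>\<^bsub>L'\<^esub> prod_map (\<lambda>r. h) x q) \<in> carrier (lim_mod cod.piece incl_diag)"
      using uY x D.prod_map_shift_diff by (intro cod.shift_diff_eq_imp Y hx) simp
    then obtain v where v: "v \<in> carrier (lim_mod dom.piece incl_diag)"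
      "prod_map (\<lambda>r. h) v = (\<lambda>q. Y q \<ominus>\<^bsub>L'\<^esub> prod_map (\<lambda>r. h) x q)"
      unfolding lim[symmetric] by force
    have c: "x r \<in> carrier L" "v r \<in> carrier L"
      using x(1) v(1) dom.sub by (auto simp: prod_mod_def lim_mod_def)
    have yc: "y \<in> carrier L'" using Y cod.sub by (auto simp: prod_mod_def)
    have "h (v r) = y \<ominus>\<^bsub>L'\<^esub> h (x r)" using fun_cong[OF v(2), of r] Y(2) by (simp add: prod_map_def)
    then have "h (v r \<oplus>\<^bsub>L\<^esub> x r) = y"
      using c yc lin_hom_closed[OF h]
      by (simp add: lin_hom_add[OF h] cod.M.minus_eq cod.M.a_assoc cod.M.l_neg)
    then show "y \<in> h ` carrier L" using c by blast
  qed
qed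

text \<open>Injectivity on the graded pieces pushes an element of the kernel down to the intersection of
  the filtration, whose elements are the constant families in the limit.\<close>

theorem injective:
  assumes gr: "\<And>r. inj_on (gr_map r) (carrier (gr_dom r))"
    and lim: "inj_on (prod_map (\<lambda>r. h)) (carrier (lim_mod dom.piece incl_diag))"
  shows "inj_on h (carrier L)"
proof (rule inj_onI)
  fix x1 x2 assume x12: "x1 \<in> carrier L" "x2 \<in> carrier L" "h x1 = h x2"
  define x where "x = x1 \<ominus>\<^bsub>L\<^esub> x2"
  have xL: "x \<in> carrier L" using x12 by (simp add: x_def)
  have hx: "h x = \<zero>\<^bsub>L'\<^esub>"
    using x12 lin_hom_closed[OF h] lin_hom_minus[OF dom.left_module_axioms cod.left_module_axioms h]
    by (simp add: x_def cod.minus_zero_iff)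
  have zF: "\<zero>\<^bsub>L\<^esub> \<in> F q" "\<zero>\<^bsub>L'\<^esub> \<in> F' q" for q
    using subgroup.one_closed[OF submodule.axioms(1)[OF dom.submod, of q]]
      subgroup.one_closed[OF submodule.axioms(1)[OF cod.submod, of q]] by auto
  obtain r where "x \<in> F r" using xL dom.exhaustive by auto
  have down: "x \<in> F (q - 1)" if "x \<in> F q" for q
    using quot_map_inj_imp[OF gr_facts gr, of x q] that zF hx by simp
  have "x \<in> F q" if "q \<le> r" for q
    using that by (induction q rule: int_le_induct) (use \<open>x \<in> F r\<close> down in auto)
  moreover have "x \<in> F q" if "r \<le> q" for q using dom.mono[OF that] \<open>x \<in> F r\<close> by auto
  ultimately have "x \<in> F q" for q by (meson linear)
  then have "(\<lambda>q. x) \<in> carrier (lim_mod dom.piece incl_diag)"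
    "(\<lambda>q. \<zero>\<^bsub>L\<^esub>) \<in> carrier (lim_mod dom.piece incl_diag)"
    using zF by (auto simp: lim_mod_def prod_mod_def)
  moreover have "prod_map (\<lambda>r. h) (\<lambda>q. x) = prod_map (\<lambda>r. h) (\<lambda>q. \<zero>\<^bsub>L\<^esub>)"
    using hx lin_hom_zero[OF dom.left_module_axioms cod.left_module_axioms h] by (simp add: prod_map_def)
  ultimately have "(\<lambda>q::int. x) = (\<lambda>q. \<zero>\<^bsub>L\<^esub>)" using lim by (blast dest: inj_onD)
  then have "x = \<zero>\<^bsub>L\<^esub>" by meson
  then show "x1 = x2" using x12 by (simp add: x_def dom.minus_zero_iff)
qed

end


section \<open>Directed colimits as filtered modules\<close>

context int_diagram
begin

lemma germ_steps:
  assumes x: "x \<in> carrier (M r)"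
  shows "germ M t (r + int k) (steps t r k x) = germ M t r x"
  unfolding germ_eq_iff[OF steps_closed[OF x] x]
  by (intro exI[of _ 0] exI[of _ k]) simp

text \<open>The zero of the colimit is by definition a germ at stage \<^verbatim>\<open>0\<close>.  It meets the germ of zero at stage
  \<^verbatim>\<open>r\<close> at stage \<^verbatim>\<open>max r 0\<close>, hence the step numbers \<^verbatim>\<open>nat (- r)\<close> and \<^verbatim>\<open>nat r\<close>.\<close>

lemma germ_zero: "germ M t r \<zero>\<^bsub>M r\<^esub> = \<zero>\<^bsub>colim_mod M t\<^esub>"
proof -
  interpret M: left_module R "M q" for q by (rule obj)
  have "germ M t r \<zero>\<^bsub>M r\<^esub> = germ M t 0 \<zero>\<^bsub>M 0\<^esub>"
    unfolding germ_eq_iff[OF M.M.zero_closed M.M.zero_closed]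
    by (intro exI[of _ "nat (- r)"] exI[of _ "nat r"])
      (auto simp: lin_hom_zero[OF obj obj steps_hom])
  then show ?thesis by (simp add: colim_mod_def)
qed

lemma colim_lift:
  assumes "X \<in> carrier (colim_mod M t)"
  shows "\<exists>r. \<forall>s\<ge>r. \<exists>x\<in>carrier (M s). X = germ M t s x"
proof -
  obtain r x where x: "x \<in> carrier (M r)" "X = germ M t r x" using assms by (auto simp: colim_mod_def)
  have "\<exists>y\<in>carrier (M s). X = germ M t s y" if "s \<ge> r" for s
    using germ_steps[OF x(1), of "nat (s - r)"] steps_closed[OF x(1), of "nat (s - r)"] that x(2) by auto
  then show ?thesis by blast
qed

text \<open>The operations on germs are computed only between representatives at one stage.  Three germs
  at a time suffice, as associativity is the law with the most variables.\<close>

lemma colim_common_stage: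
  assumes "X \<in> carrier (colim_mod M t)" "Y \<in> carrier (colim_mod M t)" "Z \<in> carrier (colim_mod M t)"
  obtains r x y z where "x \<in> carrier (M r)" "y \<in> carrier (M r)" "z \<in> carrier (M r)"
    "X = germ M t r x" "Y = germ M t r y" "Z = germ M t r z"
proof -
  obtain a b c where "\<forall>s\<ge>a. \<exists>x\<in>carrier (M s). X = germ M t s x"
    "\<forall>s\<ge>b. \<exists>x\<in>carrier (M s). Y = germ M t s x" "\<forall>s\<ge>c. \<exists>x\<in>carrier (M s). Z = germ M t s x"
    using assms[THEN colim_lift] by blast
  moreover have "max a (max b c) \<ge> a" "max a (max b c) \<ge> b" "max a (max b c) \<ge> c" by auto
  ultimately show ?thesis using that by meson
qed

lemma germ_closed: "x \<in> carrier (M r) \<Longrightarrow> germ M t r x \<in> carrier (colim_mod M t)"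
  by (auto simp: colim_mod_def)

lemma colim_left_module: "left_module R (colim_mod M t)"
proof -
  interpret M: left_module R "M q" for q by (rule obj)
  let ?L = "colim_mod M t"
  have rep: "\<exists>r. \<exists>x\<in>carrier (M r). X = germ M t r x" if "X \<in> carrier ?L" for X
    using that by (auto simp: colim_mod_def)
  have ag: "abelian_group ?L"
  proof (rule abelian_groupI)
    fix X Y assume "X \<in> carrier ?L" "Y \<in> carrier ?L"
    then obtain r x y where *: "x \<in> carrier (M r)" "y \<in> carrier (M r)" "X = germ M t r x" "Y = germ M t r y"
      by (metis colim_common_stage)
    then show "X \<oplus>\<^bsub>?L\<^esub> Y \<in> carrier ?L" "X \<oplus>\<^bsub>?L\<^esub> Y = Y \<oplus>\<^bsub>?L\<^esub> X"
      by (auto simp: colim_add_germ M.M.a_comm intro: germ_closed)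
  next
    fix X Y Z assume "X \<in> carrier ?L" "Y \<in> carrier ?L" "Z \<in> carrier ?L"
    then obtain r x y z where "x \<in> carrier (M r)" "y \<in> carrier (M r)" "z \<in> carrier (M r)"
      "X = germ M t r x" "Y = germ M t r y" "Z = germ M t r z"
      by (rule colim_common_stage)
    then show "X \<oplus>\<^bsub>?L\<^esub> Y \<oplus>\<^bsub>?L\<^esub> Z = X \<oplus>\<^bsub>?L\<^esub> (Y \<oplus>\<^bsub>?L\<^esub> Z)"
      by (simp add: colim_add_germ M.M.a_assoc)
  next
    fix X assume "X \<in> carrier ?L"
    then obtain r x where x: "x \<in> carrier (M r)" "X = germ M t r x" using rep by blast
    then show "\<zero>\<^bsub>?L\<^esub> \<oplus>\<^bsub>?L\<^esub> X = X"
      by (simp add: colim_add_germ flip: germ_zero[of r])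
    show "\<exists>Y\<in>carrier ?L. Y \<oplus>\<^bsub>?L\<^esub> X = \<zero>\<^bsub>?L\<^esub>"
      using x by (intro bexI[of _ "germ M t r (\<ominus>\<^bsub>M r\<^esub> x)"])
        (auto simp: colim_add_germ M.M.l_neg germ_zero intro: germ_closed)
  next
    show "\<zero>\<^bsub>?L\<^esub> \<in> carrier ?L" using germ_closed[of "\<zero>\<^bsub>M 0\<^esub>" 0] germ_zero[of 0] by simp
  qed
  show ?thesis
  proof (intro left_module.intro M.R.ring_axioms ag left_module_axioms.intro)
    fix X assume "X \<in> carrier ?L"
    then obtain r x where x: "x \<in> carrier (M r)" "X = germ M t r x" using rep by blast
    show "\<one>\<^bsub>R\<^esub> \<odot>\<^bsub>?L\<^esub> X = X" using x by (simp add: colim_smult_germ)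
    fix c assume c: "c \<in> carrier R"
    show "c \<odot>\<^bsub>?L\<^esub> X \<in> carrier ?L" using c x by (auto simp: colim_smult_germ intro: germ_closed)
    fix d assume d: "d \<in> carrier R"
    show "(c \<oplus>\<^bsub>R\<^esub> d) \<odot>\<^bsub>?L\<^esub> X = c \<odot>\<^bsub>?L\<^esub> X \<oplus>\<^bsub>?L\<^esub> d \<odot>\<^bsub>?L\<^esub> X"
      "(c \<otimes>\<^bsub>R\<^esub> d) \<odot>\<^bsub>?L\<^esub> X = c \<odot>\<^bsub>?L\<^esub> (d \<odot>\<^bsub>?L\<^esub> X)"
      using c d x by (simp_all add: colim_smult_germ colim_add_germ M.smult_l_distr M.smult_assoc1)
  next
    fix c X Y assume c: "c \<in> carrier R" and "X \<in> carrier ?L" "Y \<in> carrier ?L"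
    then obtain r x y where "x \<in> carrier (M r)" "y \<in> carrier (M r)" "X = germ M t r x" "Y = germ M t r y"
      by (metis colim_common_stage)
    then show "c \<odot>\<^bsub>?L\<^esub> (X \<oplus>\<^bsub>?L\<^esub> Y) = c \<odot>\<^bsub>?L\<^esub> X \<oplus>\<^bsub>?L\<^esub> c \<odot>\<^bsub>?L\<^esub> Y"
      using c by (simp add: colim_smult_germ colim_add_germ M.smult_r_distr)
  qed
qed

lemma germ_hom: "germ M t r \<in> lin_hom R (M r) (colim_mod M t)"
  by (auto simp: lin_hom_def germ_closed colim_add_germ colim_smult_germ)

lemma colim_filtered: "filtered_module R (colim_mod M t) (\<lambda>r. germ M t r ` carrier (M r))"
proof (intro filtered_module.intro filtered_module_axioms.intro colim_left_module)
  show "submodule (germ M t r ` carrier (M r)) R (colim_mod M t)" for r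
    by (rule lin_hom_image_submodule[OF obj colim_left_module germ_hom])
  show "germ M t r ` carrier (M r) \<subseteq> germ M t (r + 1) ` carrier (M (r + 1))" for r
    using germ_step lin_hom_closed[OF arr] by (metis (no_types, lifting) image_eqI image_subsetI)
  show "carrier (colim_mod M t) = (\<Union>r. germ M t r ` carrier (M r))"
    by (auto simp: colim_mod_def)
qed

end

lemma (in int_diagram_hom) colim_filtered_hom:
  "filtered_hom R (colim_mod M t) (\<lambda>r. germ M t r ` carrier (M r))
    (colim_mod N u) (\<lambda>r. germ N u r ` carrier (N r)) (colim_map N u f)"
proof (intro filtered_hom.intro filtered_hom_axioms.intro dom.colim_filtered cod.colim_filtered)
  show "colim_map N u f ` germ M t r ` carrier (M r) \<subseteq> germ N u r ` carrier (N r)" for r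
    using lin_hom_closed[OF hom] by (auto simp: colim_map_germ)
  interpret M: left_module R "M q" for q by (rule dom.obj)
  show "colim_map N u f \<in> lin_hom R (colim_mod M t) (colim_mod N u)"
    unfolding lin_hom_def
  proof (intro CollectI conjI ballI funcsetI)
    fix X assume "X \<in> carrier (colim_mod M t)"
    then obtain r x where x: "x \<in> carrier (M r)" "X = germ M t r x" by (auto simp: colim_mod_def)
    then show "colim_map N u f X \<in> carrier (colim_mod N u)"
      using lin_hom_closed[OF hom] by (auto simp: colim_map_germ intro: cod.germ_closed)
    show "colim_map N u f (c \<odot>\<^bsub>colim_mod M t\<^esub> X) = c \<odot>\<^bsub>colim_mod N u\<^esub> colim_map N u f X"
      if "c \<in> carrier R" for c
      using x that lin_hom_closed[OF hom] lin_hom_smult[OF hom]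
      by (simp add: dom.colim_smult_germ cod.colim_smult_germ colim_map_germ)
  next
    fix X Y assume "X \<in> carrier (colim_mod M t)" "Y \<in> carrier (colim_mod M t)"
    then obtain r x y where "x \<in> carrier (M r)" "y \<in> carrier (M r)" "X = germ M t r x" "Y = germ M t r y"
      by (metis dom.colim_common_stage)
    then show "colim_map N u f (X \<oplus>\<^bsub>colim_mod M t\<^esub> Y) = colim_map N u f X \<oplus>\<^bsub>colim_mod N u\<^esub> colim_map N u f Y"
      using lin_hom_closed[OF hom] lin_hom_add[OF hom]
      by (simp add: dom.colim_add_germ cod.colim_add_germ colim_map_germ)
  qed
qed


section \<open>The colimit abutment of a regular exact couple\<close>

lemma (in couple_morphism) diag_pt_eq: "diag_pt C' n r = diag_pt C n r"
  by (simp add: diag_pt_def sigma_def deg_eq)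

lemma (in couple_morphism) diag_hom:
  "int_diagram_hom R (D_diag C n) (i_diag C n) (D_diag C' n) (i_diag C' n) (\<lambda>r. fD (diag_pt C' n r))"
  using comm_i[of _ "diag_pt C n r" for r] 
  by (intro int_diagram_hom.intro int_diagram_hom_axioms.intro dom.diag_int_diagram cod.diag_int_diagram)
    (auto simp: diag_pt_eq fD_hom diag_pt_step)

theorem lemma2p5p3:
  fixes R :: "('r, 'z) ring_scheme"
    and C1 :: "('r, 'd1, 'e1) couple" and C2 :: "('r, 'd2, 'e2) couple"
    and fD :: "bideg \<Rightarrow> 'd1 \<Rightarrow> 'd2" and fE :: "bideg \<Rightarrow> 'e1 \<Rightarrow> 'e2" and n :: int
  assumes "regular_exact_couple R C1" and "regular_exact_couple R C2"
    and "couple_morphism R C1 C2 fD fE"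
    and "\<And>x. bidet (deg_a C1) x = n \<Longrightarrow> eps_map C2 fD x \<in> lin_iso R (eps_mod C1 x) (eps_mod C2 x)"
    and "limF_map C2 fD n \<in> lin_epi R (limF_mod C1 n) (limF_mod C2 n)"
    and "lim1F_map C2 fD n \<in> lin_mono R (lim1F_mod C1 n) (lim1F_mod C2 n)"
  shows "L_map C2 fD n \<in> lin_epi R (L_mod C1 n) (L_mod C2 n) \<and>
    (limF_map C2 fD n \<in> lin_iso R (limF_mod C1 n) (limF_mod C2 n)
      \<longrightarrow> L_map C2 fD n \<in> lin_iso R (L_mod C1 n) (L_mod C2 n))"
proof -
  interpret C1: regular_exact_couple R C1 by fact
  interpret C2: regular_exact_couple R C2 by fact
  interpret f: couple_morphism R C1 C2 fD fE by fact
  \<comment> \<open>The filtration steps \<^verbatim>\<open>F_mod\<close> along the diagonal are the images of the modules \<^verbatim>\<open>D\<close> in the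
    abutment; regularity
    makes the position \<^verbatim>\<open>r\<close> on the diagonal unique.\<close>
  define G1 where "G1 = (\<lambda>r. germ (D_diag C1 n) (i_diag C1 n) r ` carrier (D_diag C1 n r))"
  define G2 where "G2 = (\<lambda>r. germ (D_diag C2 n) (i_diag C2 n) r ` carrier (D_diag C2 n r))"
  have F1: "F_mod C1 (diag_pt C1 n r) = (L_mod C1 n)\<lparr>carrier := G1 r\<rparr>" for r
    unfolding G1_def by (rule C1.F_diag_eq)
  have F2: "F_mod C2 (diag_pt C2 n r) = (L_mod C2 n)\<lparr>carrier := G2 r\<rparr>" for r
    unfolding G2_def by (rule C2.F_diag_eq)
  interpret h: filtered_hom R "L_mod C1 n" G1 "L_mod C2 n" G2 "L_map C2 fD n"
    unfolding L_mod_def L_map_def G1_def G2_def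
    by (rule int_diagram_hom.colim_filtered_hom[OF f.diag_hom])
  have prev1: "diag_pt C1 n r - deg_a C1 = diag_pt C1 n (r - 1)" for r
    using diag_pt_step[of C1 n "r - 1"] by (metis add_diff_cancel_right' diff_add_cancel)
  have prev2: "diag_pt C2 n r - deg_a C2 = diag_pt C2 n (r - 1)" for r
    using diag_pt_step[of C2 n "r - 1"] by (metis add_diff_cancel_right' diff_add_cancel)
  have gr: "bij_betw (h.gr_map r) (carrier (h.gr_dom r)) (carrier (h.gr_cod r))" for r
  proof -
    have "bidet (deg_a C1) (diag_pt C1 n r) = n" using C1.bidet_eq_iff by blast
    moreover have "bidet (deg_a C2) (diag_pt C2 n r) = n" using C2.bidet_eq_iff by blast
    moreover have "eps_mod C1 (diag_pt C1 n r) = h.gr_dom r" "eps_mod C2 (diag_pt C2 n r) = h.gr_cod r"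
      by (simp_all add: eps_mod_def prev1 prev2 F1 F2)
    ultimately show ?thesis using assms(4)[of "diag_pt C1 n r"]
      by (simp add: lin_iso_def eps_map_def F2 prev2 flip: f.diag_pt_eq)
  qed
  have lim_eqs: "limF_mod C1 n = lim_mod h.dom.piece incl_diag" "limF_mod C2 n = lim_mod h.cod.piece incl_diag"
    "lim1F_mod C1 n = lim1_mod h.dom.piece incl_diag"
    "limF_map C2 fD n = prod_map (\<lambda>r. L_map C2 fD n)"
    "lim1F_map C2 fD n = lim1_map h.cod.piece incl_diag (\<lambda>r. L_map C2 fD n)"
    by (simp_all add: limF_mod_def lim1F_mod_def limF_map_def lim1F_map_def F1 F2)
  have surj: "L_map C2 fD n ` carrier (L_mod C1 n) = carrier (L_mod C2 n)"
  proof (rule h.surjective)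
    show "h.gr_map r ` carrier (h.gr_dom r) = carrier (h.gr_cod r)" for r
      using gr by (rule bij_betw_imp_surj_on)
  qed (use assms(5,6) in \<open>auto simp: lin_epi_def lin_mono_def lim_eqs\<close>)
  have inj: "inj_on (L_map C2 fD n) (carrier (L_mod C1 n))"
    if "limF_map C2 fD n \<in> lin_iso R (limF_mod C1 n) (limF_mod C2 n)"
  proof (rule h.injective)
    show "inj_on (h.gr_map r) (carrier (h.gr_dom r))" for r using gr by (rule bij_betw_imp_inj_on)
  qed (use that in \<open>auto simp: lin_iso_def bij_betw_def lim_eqs\<close>)
  show ?thesis using h.h surj inj by (auto simp: lin_epi_def lin_iso_def bij_betw_def)
qed

end
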